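(* Every simple edge-colored graph on $n$ vertices with at least $1.1077\,n$ color classes, each containing at least $n/3$ edges, contains a rainbow triangle. Moreover, every simple edge-colored graph on $n$ vertices with at least $1.3481\,n$ color classes, each containing at least $n/4$ edges, contains a rainbow triangle.
   Context: An edge-coloring of a graph $G$ is an arbitrary map $f:E(G)\to\mathbb{N}$ (not necessarily proper); for a color $i$, the set $f^{-1}(i)$ is the color class of $i$. A rainbow triangle is a triangle in $G$ whose three edges have pairwise distinct colors. A graph is simple if it has no loops or parallel edges. (In the paper's terminology, the pairs $(1.1077,1/3)$ and $(1.3481,1/4)$ are "triangular", where $(\alpha,\beta)$ is triangular if every simple edge-colored graph on $n$ vertices with at least $\alpha n$ color classes, each with at least $\beta n$ edges, has a rainbow triangle.) *)

theory Defs
  imports Complex_Main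
begin

text \<open>
  A finite simple undirected graph is a finite vertex set \<open>V\<close> with a set \<open>E\<close> of two-element
  subsets of \<open>V\<close>: loops are excluded by the cardinality, parallel edges by \<open>E\<close> being a set.
\<close>

definition simple_graph :: "'a set \<Rightarrow> 'a set set \<Rightarrow> bool" where
  "simple_graph V E \<longleftrightarrow> finite V \<and> E \<subseteq> {e. e \<subseteq> V \<and> card e = 2}"

text \<open>
  An edge-coloring is a total function on sets of vertices, of which only the values on \<open>E\<close> are
  used; hence the preimage of a color is cut down to \<open>E\<close>.
\<close>

definition color_class :: "'a set set \<Rightarrow> ('a set \<Rightarrow> nat) \<Rightarrow> nat \<Rightarrow> 'a set set" where
  "color_class E f i = {e \<in> E. f e = i}"

definition rainbow_triangle ::
    "'a set set \<Rightarrow> ('a set \<Rightarrow> nat) \<Rightarrow> 'a \<Rightarrow> 'a \<Rightarrow> 'a \<Rightarrow> bool" where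
  "rainbow_triangle E f x y z \<longleftrightarrow>
     distinct [x, y, z] \<and> {{x, y}, {y, z}, {x, z}} \<subseteq> E \<and>
     distinct [f {x, y}, f {y, z}, f {x, z}]"

end

theory Submission
  imports Defs
begin

text \<open>
  Trim every color class to \<open>k = \<lceil>\<beta>n\<rceil>\<close> edges. Without rainbow triangles every triangle has two
  edges of one color; choose such a pair and call its common vertex the apex. For an edge \<open>uv\<close>
  let, in units of \<open>n\<close>, \<open>f(u,v)\<close> count the triangles on \<open>uv\<close> whose apex is the third vertex,
  \<open>g(u,v)\<close> those with apex \<open>u\<close>, and \<open>w(u,v)\<close> the common non-neighbors. Then
  \<open>f(u,v) + g(u,v) + g(v,u) = d(u) + d(v) - 1 + w(u,v)\<close>, the size of the color class gives
  \<open>g(u,v) + g(v,u) < \<beta>\<close>, and \<open>\<Sum>\<^sub>v f(u,v) = \<Sum>\<^sub>v g(v,u)\<close> for every \<open>u\<close>.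
  With \<open>w \<ge> 0\<close> alone this only yields \<open>\<alpha> = 9/8\<close> and \<open>\<alpha> = 11/8\<close>.

  The improvement comes from a second moment. If the bound on \<open>g\<close> is nearly sharp, the leaves of
  a monochromatic star nearly form a clique of triangles whose apex is the center. For a vertex
  \<open>t\<close> sum over the leaves \<open>u\<close> the centered indicators of \<open>u\<close> and \<open>t\<close> being non-adjacent, weighted
  by \<open>\<eta>(u) = 3/2 - d(u)\<close>. The square of this sum is nonnegative; summing over all \<open>t\<close> and all
  stars shows that \<open>w(u,v) - (1 - d(u))(1 - d(v))\<close> is nonnegative on average with respect to the
  weights \<open>f(u,v)\<eta>(u)\<eta>(v)\<close>, up to a loss controlled by \<open>\<beta> - g(u,v) - g(v,u)\<close>. Adding this, the
  identity between \<open>f\<close> and \<open>g\<close> with multipliers \<open>\<mu> - \<nu>(1 - d(u))\<close>, and the lower bound on the number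
  of edges with multiplier \<open>c\<close>, one gets a sum over the edges that cannot be positive, although
  every single summand is.
\<close>

section \<open>The contribution of an edge\<close>

text \<open>A concave function lies above its chord: the identity below splits off the chord between
  \<open>l\<close> and \<open>u\<close>, and what remains is \<open>K\<close> times nonnegative
  factors.\<close>

lemma concave_quadratic_pos:
  fixes A B K l u w :: real
  assumes "0 \<le> K" "l \<le> w" "w \<le> u"
    and "0 < A + B * l - K * l\<^sup>2" "0 < A + B * u - K * u\<^sup>2"
  shows "0 < A + B * w - K * w\<^sup>2"
proof (cases "l = u")
  case True
  then show ?thesis using assms by simp
next
  case False
  then have lu: "l < u" using assms by simp
  have "(u - l) * (A + B * w - K * w\<^sup>2) =
      (u - w) * (A + B * l - K * l\<^sup>2) + (w - l) * (A + B * u - K * u\<^sup>2)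
      + K * ((w - l) * (u - w) * (u - l))"
    by (simp add: power2_eq_square algebra_simps)
  moreover have "0 \<le> K * ((w - l) * (u - w) * (u - l))"
    using assms lu by (intro mult_nonneg_nonneg) auto
  moreover have "0 < (u - w) * (A + B * l - K * l\<^sup>2) + (w - l) * (A + B * u - K * u\<^sup>2)"
  proof (cases "w = u")
    case True then show ?thesis using assms lu by simp
  next
    case False
    then show ?thesis using assms by (intro add_pos_nonneg mult_pos_pos mult_nonneg_nonneg) auto
  qed
  ultimately have "0 < (u - l) * (A + B * w - K * w\<^sup>2)" by linarith
  then show ?thesis using lu by (simp add: zero_less_mult_iff)
qed

text \<open>
  \<open>edge_val\<close> is a lower bound for the contribution of an edge with \<open>1 - d(u) = h - r\<close>,
  \<open>1 - d(v) = h + r\<close> and \<open>g = g(u,v) + g(v,u)\<close>, where \<open>(1/2 + h)\<^sup>2 - r\<^sup>2 = \<eta>(u)\<eta>(v)\<close>. It is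
  concave in \<open>w\<close> and affine in \<open>g\<close>, so it suffices to check the vertices \<open>A1\<close>, \<open>A2\<close> (\<open>g = \<beta>\<close>),
  \<open>B\<close> (\<open>f = 0\<close>) and \<open>C1\<close>, \<open>C2\<close> (\<open>g = 0\<close>) of the region of admissible \<open>(w, g)\<close>.
\<close>

locale weights =
  fixes \<beta> \<delta> \<mu> \<nu> c :: real
begin

text \<open>Every neighbor of \<open>u\<close> contributes \<open>\<delta> / d(u) - 1\<close>, so a
  vertex of positive degree contributes \<open>\<delta> - d(u)\<close> in total. This spreads the
  lower bound on the number of edges over the edges.\<close>

definition deg_gain :: "real \<Rightarrow> real \<Rightarrow> real" where
  "deg_gain h r = c * (\<delta> / (1 - h + r) + \<delta> / (1 - h - r) - 2)"

definition edge_val :: "real \<Rightarrow> real \<Rightarrow> real \<Rightarrow> real \<Rightarrow> real" where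
  "edge_val h r w g = (let f = 1 - 2 * h + w - g in
     2 * (\<mu> - \<nu> * h) * f - (\<mu> - \<nu> * h + \<nu> * r) * g
     - 2 * f * ((1/2 + h)\<^sup>2 - r\<^sup>2) * (w - h\<^sup>2 + r\<^sup>2) - (h + r) * (\<beta> - g) + deg_gain h r)"

end

locale good_weights = weights +
  assumes beta: "0 < \<beta>" "\<beta> < 1" and nu: "0 \<le> \<nu>"
    and A1: "\<And>h r. 0 \<le> r \<Longrightarrow> r \<le> h \<Longrightarrow> h + r < 1 \<Longrightarrow> 0 \<le> 1 - 2 * h - \<beta> \<Longrightarrow> 0 < edge_val h r 0 \<beta>"
    \<comment> \<open>\<open>w = h\<close> lies beyond the admissible bound \<open>h - r\<close>,
      but keeps \<open>f\<close> and \<open>w - h\<^sup>2 + r\<^sup>2\<close> free of terms linear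
      in \<open>r\<close>.\<close>
    and A2: "\<And>h r. 0 \<le> r \<Longrightarrow> r \<le> h \<Longrightarrow> h + r < 1 \<Longrightarrow> 0 \<le> 1 - h - \<beta> \<Longrightarrow> 0 < edge_val h r h \<beta>"
    and B: "\<And>h r g. 0 \<le> r \<Longrightarrow> r \<le> h \<Longrightarrow> h + r < 1 \<Longrightarrow> 1 - 2 * h \<le> g \<Longrightarrow> 0 \<le> g \<Longrightarrow> g \<le> \<beta>
         \<Longrightarrow> 0 < edge_val h r (g - (1 - 2 * h)) g"
    and C1: "\<And>h r. 0 \<le> r \<Longrightarrow> r \<le> h \<Longrightarrow> h + r < 1 \<Longrightarrow> h \<le> 1/2 \<Longrightarrow> 0 < edge_val h r 0 0"
    and C2: "\<And>h r. 0 \<le> r \<Longrightarrow> r \<le> h \<Longrightarrow> h + r < 1 \<Longrightarrow> 0 < edge_val h r (h - r) 0"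
begin

lemma edge_val_pos_segment_w:
  assumes "0 \<le> r" "r \<le> h" "l \<le> w" "w \<le> u" "0 < edge_val h r l g" "0 < edge_val h r u g"
  shows "0 < edge_val h r w g"
proof -
  define Q where "Q = (1/2 + h)\<^sup>2 - r\<^sup>2"
  define f0 where "f0 = 1 - 2 * h - g"
  define A where "A = edge_val h r 0 g"
  define B where "B = 2 * (\<mu> - \<nu> * h) - 2 * f0 * Q + 2 * Q * (h\<^sup>2 - r\<^sup>2)"
  have "edge_val h r t g = A + B * t - 2 * Q * t\<^sup>2" for t
    unfolding A_def B_def edge_val_def Let_def Q_def[symmetric] f0_def
    by (simp add: power2_eq_square algebra_simps)
  moreover have "0 \<le> 2 * Q"
    unfolding Q_def using assms by (simp add: power_mono)
  ultimately show ?thesis using concave_quadratic_pos[of "2 * Q" l w u A B] assms by simp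
qed

lemma edge_val_pos_segment_g:
  assumes "l \<le> g" "g \<le> u" "0 < edge_val h r w l" "0 < edge_val h r w u"
  shows "0 < edge_val h r w g"
proof -
  define Q where "Q = (1/2 + h)\<^sup>2 - r\<^sup>2"
  define A where "A = edge_val h r w 0"
  define B where "B = - 2 * (\<mu> - \<nu> * h) - (\<mu> - \<nu> * h + \<nu> * r) + 2 * Q * (w - h\<^sup>2 + r\<^sup>2) + (h + r)"
  have "edge_val h r w t = A + B * t - 0 * t\<^sup>2" for t
    unfolding A_def B_def edge_val_def Let_def Q_def[symmetric]
    by (simp add: power2_eq_square algebra_simps)
  then show ?thesis using concave_quadratic_pos[of 0 l g u A B] assms by simp
qed

text \<open>The bottom side \<open>g = 0\<close> is reached by moving in \<open>w\<close>. The top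
  end of the vertical segment through \<open>w\<close> has either \<open>g = \<beta>\<close>, again
  reached by moving in \<open>w\<close>, or \<open>f = 0\<close>, which is \<open>B\<close>. Moving
  in \<open>g\<close> then fills the segment.\<close>

lemma edge_val_pos:
  assumes r: "0 \<le> r" "r \<le> h" "h + r < 1" and w: "0 \<le> w" "w \<le> h - r"
    and g: "0 \<le> g" "g \<le> \<beta>" "g \<le> 1 - 2 * h + w"
  shows "0 < edge_val h r w g"
proof -
  have low: "0 < edge_val h r w 0"
  proof (cases "h \<le> 1/2")
    case True
    then show ?thesis using edge_val_pos_segment_w[of r h 0 w "h - r" 0] C1[of r h] C2[of r h] r w by simp
  next
    case False
    then show ?thesis
      using edge_val_pos_segment_w[of r h "2 * h - 1" w "h - r" 0] B[of r h 0] C2[of r h] r w g beta by simp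
  qed
  show ?thesis
  proof (cases "\<beta> \<le> 1 - 2 * h + w")
    case True
    have "0 < edge_val h r w \<beta>"
    proof (cases "0 \<le> 1 - 2 * h - \<beta>")
      case True
      then show ?thesis
        using edge_val_pos_segment_w[of r h 0 w h \<beta>] A1[of r h] A2[of r h] r w by simp
    next
      case False
      then show ?thesis
        using edge_val_pos_segment_w[of r h "\<beta> - (1 - 2 * h)" w h \<beta>] B[of r h \<beta>] A2[of r h]
          r w True beta by simp
    qed
    then show ?thesis using edge_val_pos_segment_g[OF g(1,2) low] by simp
  next
    case False
    then have "0 < edge_val h r w (1 - 2 * h + w)"
      using B[of r h "1 - 2 * h + w"] r w g by simp
    then show ?thesis using edge_val_pos_segment_g[OF g(1,3) low] by simp
  qed
qed

lemma edge_ineq_ordered: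
  fixes x y w g g' :: real
  assumes x: "0 \<le> x" "x \<le> y" "y < 1" and w: "0 \<le> w" "w \<le> x"
    and g: "0 \<le> g" "0 \<le> g'" "g + g' \<le> \<beta>" and f: "f = 1 - x - y + w - g - g'" "0 \<le> f"
  shows "0 < (\<mu> - \<nu> * x) * (f - g') + (\<mu> - \<nu> * y) * (f - g)
      - 2 * f * ((1/2 + x) * (1/2 + y)) * (w - x * y) - y * (\<beta> - g - g')
      + c * (\<delta> / (1 - x) + \<delta> / (1 - y) - 2)"
proof -
  define h r where "h = (x + y) / 2" and "r = (y - x) / 2"
  have xy: "x = h - r" "y = h + r" by (simp_all add: h_def r_def field_simps)
  have "0 < edge_val h r w (g + g')"
    by (rule edge_val_pos) (use x w g f in \<open>auto simp: xy\<close>)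
  moreover have "edge_val h r w (g + g') = 2 * (\<mu> - \<nu> * h) * f - (\<mu> - \<nu> * x) * (g + g')
      - 2 * f * ((1/2 + x) * (1/2 + y)) * (w - x * y) - y * (\<beta> - g - g')
      + c * (\<delta> / (1 - x) + \<delta> / (1 - y) - 2)"
    unfolding edge_val_def Let_def deg_gain_def f xy
    by (simp add: power2_eq_square algebra_simps)
  \<comment> \<open>\<open>edge_val\<close> charges all of \<open>g + g'\<close> at the larger rate
    \<open>\<mu> - \<nu> * x\<close>; the excess is \<open>\<nu> * (y - x) * g\<close>.\<close>
  moreover have "2 * (\<mu> - \<nu> * h) * f - (\<mu> - \<nu> * x) * (g + g') \<le>
      (\<mu> - \<nu> * x) * (f - g') + (\<mu> - \<nu> * y) * (f - g)"
  proof -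
    have "0 \<le> \<nu> * (y - x) * g" using nu x g by simp
    then show ?thesis unfolding xy by (simp add: algebra_simps)
  qed
  ultimately show ?thesis by linarith
qed

lemma edge_ineq:
  fixes x y w g g' :: real
  assumes x: "0 \<le> x" "x < 1" "0 \<le> y" "y < 1" and w: "0 \<le> w" "w \<le> x" "w \<le> y"
    and g: "0 \<le> g" "0 \<le> g'" "g + g' \<le> \<beta>" and f: "f = 1 - x - y + w - g - g'" "0 \<le> f"
  shows "0 < (\<mu> - \<nu> * x) * (f - g') + (\<mu> - \<nu> * y) * (f - g)
      - 2 * f * ((1/2 + x) * (1/2 + y)) * (w - x * y) - max x y * (\<beta> - g - g')
      + c * (\<delta> / (1 - x) + \<delta> / (1 - y) - 2)"
proof (cases "x \<le> y")
  case True
  then show ?thesis using edge_ineq_ordered[of x y w g g' f] assms by (simp add: max_def)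
next
  case False
  have "0 < (\<mu> - \<nu> * y) * (f - g) + (\<mu> - \<nu> * x) * (f - g')
      - 2 * f * ((1/2 + y) * (1/2 + x)) * (w - y * x) - x * (\<beta> - g' - g)
      + c * (\<delta> / (1 - y) + \<delta> / (1 - x) - 2)"
    by (rule edge_ineq_ordered) (use False assms in auto)
  moreover have "(1/2 + y) * (1/2 + x) = (1/2 + x) * (1/2 + y)" "y * x = x * y"
    "\<beta> - g' - g = \<beta> - g - g'" "max x y = x"
    "\<delta> / (1 - y) + \<delta> / (1 - x) - 2 = \<delta> / (1 - x) + \<delta> / (1 - y) - 2"
    using False by auto
  ultimately show ?thesis by (simp only: add.commute[of "(\<mu> - \<nu> * y) * (f - g)"])
qed

end

section \<open>Vertex inequalities\<close>

text \<open>
  At each vertex the terms linear in \<open>r\<close> are absorbed by the quadratic term coming from the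
  convexity of \<open>\<delta> / d\<close>, which leaves the following inequalities in the single variable \<open>h\<close>.
\<close>

locale univariate_weights = weights +
  assumes params: "1/4 \<le> \<beta>" "\<beta> \<le> 1/3" "0 \<le> \<nu>" "\<nu> \<le> 1/10" "\<mu> \<le> 27/100"
      "0 < c" "0 < \<delta>" "6/25 \<le> c * \<delta>" "2 * \<mu> + \<beta> \<le> 4/5" "2 * \<mu> + \<beta> - 2/5 * \<nu> \<le> 19/25"
    \<comment> \<open>The left-hand sides come from completing the square in \<open>r\<close>,
      except for \<open>C2\<close>, where \<open>31/100\<close> and \<open>83/100\<close> bound a
      negative slope in \<open>r\<close>.\<close>
    and A1_low: "\<And>h. 0 \<le> h \<Longrightarrow> h \<le> 1/5 \<Longrightarrow> 5/2 * (\<nu> * \<beta>)\<^sup>2 <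
        (\<mu> - \<nu> * h) * (2 * (1 - \<beta> - 2 * h) - \<beta>) + 2 * (1 - \<beta> - 2 * h) * ((1/2 + h)\<^sup>2 * h\<^sup>2)
        + 2 * c * (\<delta> / (1 - h) - 1)"
    and A1_high: "\<And>h. 1/5 \<le> h \<Longrightarrow> h \<le> (1 - \<beta>) / 2 \<Longrightarrow> 25/28 * (\<nu> * \<beta>)\<^sup>2 <
        (\<mu> - \<nu> * h) * (2 * (1 - \<beta> - 2 * h) - \<beta>) + 2 * (1 - \<beta> - 2 * h) * ((1/2 + h)\<^sup>2 * h\<^sup>2)
        + 2 * c * (\<delta> / (1 - h) - 1)"
    and A2_low: "\<And>h. 0 \<le> h \<Longrightarrow> h \<le> 1/5 \<Longrightarrow> 5/2 * (\<nu> * \<beta>)\<^sup>2 <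
        (\<mu> - \<nu> * h) * (2 * (1 - \<beta> - h) - \<beta>) - 2 * (1 - \<beta> - h) * ((1/2 + h)\<^sup>2 * (h - h\<^sup>2))
        + 2 * c * (\<delta> / (1 - h) - 1)"
    and A2_high: "\<And>h. 1/5 \<le> h \<Longrightarrow> h \<le> 1 - \<beta> \<Longrightarrow> 25/28 * (\<nu> * \<beta>)\<^sup>2 <
        (\<mu> - \<nu> * h) * (2 * (1 - \<beta> - h) - \<beta>) - 2 * (1 - \<beta> - h) * ((1/2 + h)\<^sup>2 * (h - h\<^sup>2))
        + 2 * c * (\<delta> / (1 - h) - 1)"
    and B_low: "\<And>h. (1 - \<beta>) / 2 \<le> h \<Longrightarrow> h \<le> 1/2 \<Longrightarrow> (\<nu> * (1 - 2 * h) + (\<beta> - 1 + 2 * h))\<^sup>2 / 5 <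
        2 * c * (\<delta> / (1 - h) - 1) - (\<mu> - \<nu> * h) * (1 - 2 * h) - h * (\<beta> - 1 + 2 * h)"
    and B_high: "\<And>h. 1/2 \<le> h \<Longrightarrow> h < 1 \<Longrightarrow> \<beta>\<^sup>2 / 7 < 2 * c * (\<delta> / (1 - h) - 1) - h * \<beta>"
    and C1_low: "\<And>h. 0 \<le> h \<Longrightarrow> h \<le> 1/2 \<Longrightarrow> 25/48 * \<beta>\<^sup>2 <
        2 * (\<mu> - \<nu> * h) * (1 - 2 * h) - h * \<beta> + 2 * c * (\<delta> / (1 - h) - 1)"
    and C2_low: "\<And>h. 0 \<le> h \<Longrightarrow> h \<le> 1/5 \<Longrightarrow> 31/100 * h <
        2 * (\<mu> - \<nu> * h) * (1 - h) - 2 * (1 - h)\<^sup>2 * (1/2 + h)\<^sup>2 * h - h * \<beta> + 2 * c * (\<delta> / (1 - h) - 1)"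
    and C2_mid: "\<And>h. 1/5 \<le> h \<Longrightarrow> h \<le> 3/4 \<Longrightarrow> 0 <
        2 * (\<mu> - \<nu> * h) * (1 - h) - 2 * (1 - h)\<^sup>2 * (1/2 + h)\<^sup>2 * h - h * \<beta> + 2 * c * (\<delta> / (1 - h) - 1)"
    and C2_high: "\<And>h. 3/4 \<le> h \<Longrightarrow> h < 1 \<Longrightarrow> 83/100 * (1 - h) <
        2 * (\<mu> - \<nu> * h) * (1 - h) - 2 * (1 - h)\<^sup>2 * (1/2 + h)\<^sup>2 * h - h * \<beta> + 2 * c * (\<delta> / (1 - h) - 1)"
begin

text \<open>With \<open>v = 1 - h\<close>, the excess of \<open>1 / (v + r) + 1 / (v - r)\<close>
  over \<open>2 / v\<close> is at least \<open>2 * r\<^sup>2 / v ^ 3\<close>, and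
  \<open>1 + 3 * h + 6 * h\<^sup>2\<close> is the start of the power series of the inverse cube of
  \<open>1 - h\<close>. The factor \<open>12/25\<close> is twice the lower bound on
  \<open>c * \<delta>\<close>.\<close>

lemma deg_gain_ge:
  assumes "0 \<le> r" "r \<le> h" "h + r < 1"
  shows "2 * c * (\<delta> / (1 - h) - 1) + 12/25 * (1 + 3 * h + 6 * h\<^sup>2) * r\<^sup>2 \<le> deg_gain h r"
proof -
  define v where "v = 1 - h"
  have v: "0 < v" "v \<le> 1" "r < v" "h = 1 - v" using assms by (auto simp: v_def)
  have d: "0 < (v + r) * (v - r)" using v assms by simp
  have "1 / (v + r) + 1 / (v - r) - 2 / v = 2 * r\<^sup>2 / (v * ((v + r) * (v - r)))"
  proof -
    have "v + r \<noteq> 0" "v - r \<noteq> 0" "v \<noteq> 0" using v assms by auto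
    then show ?thesis by (simp add: divide_simps power2_eq_square) algebra
  qed
  also have "\<dots> \<ge> 2 * r\<^sup>2 * (1 + 3 * h + 6 * h\<^sup>2)"
  proof -
    have "v * ((v + r) * (v - r)) * (1 + 3 * h + 6 * h\<^sup>2) \<le> v ^ 3 * (1 + 3 * h + 6 * h\<^sup>2)"
      using v assms by (intro mult_right_mono)
        (auto simp: power3_eq_cube power2_eq_square algebra_simps intro!: add_nonneg_nonneg mult_nonneg_nonneg)
    also have "\<dots> = 1 - h ^ 3 * (10 - 15 * h + 6 * h\<^sup>2)"
      unfolding v_def by algebra
    also have "\<dots> \<le> 1"
    proof -
      have "10 - 15 * h + 6 * h\<^sup>2 = 6 * (h - 5/4)\<^sup>2 + 5/8"
        by (simp add: power2_eq_square algebra_simps)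
      then have "0 \<le> 10 - 15 * h + 6 * h\<^sup>2" by simp
      then show ?thesis using assms by simp
    qed
    finally have "1 + 3 * h + 6 * h\<^sup>2 \<le> 1 / (v * ((v + r) * (v - r)))"
      using d v(1) by (subst pos_le_divide_eq) (auto simp: mult.commute)
    then have "2 * r\<^sup>2 * (1 + 3 * h + 6 * h\<^sup>2) \<le> 2 * r\<^sup>2 * (1 / (v * ((v + r) * (v - r))))"
      by (intro mult_left_mono) auto
    then show ?thesis by simp
  qed
  finally have *: "2 * r\<^sup>2 * (1 + 3 * h + 6 * h\<^sup>2) \<le> 1 / (v + r) + 1 / (v - r) - 2 / v" .
  have "6/25 * (2 * r\<^sup>2 * (1 + 3 * h + 6 * h\<^sup>2)) \<le> c * \<delta> * (2 * r\<^sup>2 * (1 + 3 * h + 6 * h\<^sup>2))"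
    using params assms by (intro mult_right_mono) auto
  also have "\<dots> \<le> c * \<delta> * (1 / (v + r) + 1 / (v - r) - 2 / v)"
    using params * by (intro mult_left_mono) auto
  finally show ?thesis
    unfolding deg_gain_def v_def by (simp add: algebra_simps)
qed

lemma linear_quadratic_ge:
  fixes p q r n :: real
  assumes "0 < q" "q \<le> p"
  shows "- (n\<^sup>2 / (4 * q)) \<le> p * r\<^sup>2 - n * r"
proof -
  have "q * r\<^sup>2 - n * r + n\<^sup>2 / (4 * q) = q * (r - n / (2 * q))\<^sup>2"
    using assms by (simp add: power2_eq_square field_simps)
  moreover have "0 \<le> q * (r - n / (2 * q))\<^sup>2" using assms by simp
  moreover have "q * r\<^sup>2 \<le> p * r\<^sup>2" using assms by (intro mult_right_mono) auto
  ultimately show ?thesis by linarith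
qed

text \<open>\<open>5/2\<close> and \<open>25/28\<close> are \<open>1 / (4 * q)\<close> for
  \<open>q = 1/10\<close> and \<open>q = 7/25\<close>, the values of \<open>1/10 + 9/10 * h\<close>
  at \<open>h = 0\<close> and \<open>h = 1/5\<close>.\<close>

lemma quadratic_loss:
  assumes "0 \<le> h" "1/10 + 9/10 * h \<le> p"
  shows "- (if h \<le> 1/5 then 5/2 else 25/28) * (\<nu> * \<beta>)\<^sup>2 \<le> p * r\<^sup>2 - \<nu> * \<beta> * r"
  using linear_quadratic_ge[of "1/10" p "\<nu> * \<beta>" r] linear_quadratic_ge[of "7/25" p "\<nu> * \<beta>" r] assms
  by auto

lemma vertex_A1:
  assumes "0 \<le> r" "r \<le> h" "h + r < 1" "0 \<le> 1 - 2 * h - \<beta>"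
  shows "0 < edge_val h r 0 \<beta>"
proof -
  define \<phi> where "\<phi> = 1 - \<beta> - 2 * h"
  \<comment> \<open>The net coefficient of \<open>r\<^sup>2\<close>: the convexity gain minus the
    loss in the product with \<open>\<phi>\<close>, the value of \<open>f\<close> here. By
    \<open>\<beta> \<ge> 1/4\<close> it stays above the line that \<open>quadratic_loss\<close>
    needs.\<close>
  define p where "p = 12/25 * (1 + 3 * h + 6 * h\<^sup>2) - 2 * \<phi> * ((1/2 + h)\<^sup>2 + h\<^sup>2)"
  have phi: "0 \<le> \<phi>" "\<phi> \<le> 3/4 - 2 * h" using assms params by (auto simp: \<phi>_def)
  have "2 * \<phi> * ((1/2 + h)\<^sup>2 + h\<^sup>2) \<le> 2 * (3/4 - 2 * h) * ((1/2 + h)\<^sup>2 + h\<^sup>2)"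
    using phi by (intro mult_right_mono) auto
  also have "\<dots> = 12/25 * (1 + 3 * h + 6 * h\<^sup>2) - (21/200 + 47/50 * h + 97/25 * h\<^sup>2 + 8 * h ^ 3)"
    by (simp add: power2_eq_square power3_eq_cube algebra_simps)
  finally have "1/10 + 9/10 * h \<le> p"
    unfolding p_def using assms zero_le_power[of h 2] zero_le_power[of h 3] by linarith
  then have loss: "- (if h \<le> 1/5 then 5/2 else 25/28) * (\<nu> * \<beta>)\<^sup>2 \<le> p * r\<^sup>2 - \<nu> * \<beta> * r"
    using assms by (intro quadratic_loss) auto
  have main: "(if h \<le> 1/5 then 5/2 else 25/28) * (\<nu> * \<beta>)\<^sup>2 <
      (\<mu> - \<nu> * h) * (2 * \<phi> - \<beta>) + 2 * \<phi> * ((1/2 + h)\<^sup>2 * h\<^sup>2) + 2 * c * (\<delta> / (1 - h) - 1)"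
    unfolding \<phi>_def using A1_low[of h] A1_high[of h] assms by auto
  have "edge_val h r 0 \<beta> = (\<mu> - \<nu> * h) * (2 * \<phi> - \<beta>) + 2 * \<phi> * ((1/2 + h)\<^sup>2 * h\<^sup>2)
      - \<nu> * \<beta> * r - 2 * \<phi> * ((1/2 + h)\<^sup>2 + h\<^sup>2) * r\<^sup>2 + 2 * \<phi> * (r\<^sup>2)\<^sup>2 + deg_gain h r"
    unfolding edge_val_def Let_def \<phi>_def by algebra
  moreover have "0 \<le> 2 * \<phi> * (r\<^sup>2)\<^sup>2" using phi by simp
  ultimately show ?thesis
    using loss main deg_gain_ge[OF assms(1-3)] unfolding p_def left_diff_distrib by linarith
qed

lemma vertex_A2:
  assumes "0 \<le> r" "r \<le> h" "h + r < 1" "0 \<le> 1 - h - \<beta>"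
  shows "0 < edge_val h r h \<beta>"
proof -
  define \<phi> where "\<phi> = 1 - \<beta> - h"
  define p where "p = 12/25 * (1 + 3 * h + 6 * h\<^sup>2) - 2 * \<phi> * (1/4 + 2 * h\<^sup>2)"
  have phi: "0 \<le> \<phi>" "\<phi> \<le> 3/4 - h" using assms params by (auto simp: \<phi>_def)
  have "2 * \<phi> * (1/4 + 2 * h\<^sup>2) \<le> 2 * (3/4 - h) * (1/4 + 2 * h\<^sup>2)"
    using phi by (intro mult_right_mono) auto
  also have "\<dots> = 12/25 * (1 + 3 * h + 6 * h\<^sup>2) - (21/200 + 97/50 * h - 3/25 * h\<^sup>2 + 4 * h ^ 3)"
    by (simp add: power2_eq_square power3_eq_cube algebra_simps)
  finally have "21/200 + 97/50 * h - 3/25 * h\<^sup>2 + 4 * h ^ 3 \<le> p"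
    unfolding p_def by linarith
  moreover have "h\<^sup>2 \<le> h" "0 \<le> h ^ 3" using assms by (auto simp: power2_eq_square mult_left_le)
  ultimately have "1/10 + 9/10 * h \<le> p" using assms by linarith
  then have loss: "- (if h \<le> 1/5 then 5/2 else 25/28) * (\<nu> * \<beta>)\<^sup>2 \<le> p * r\<^sup>2 - \<nu> * \<beta> * r"
    using assms by (intro quadratic_loss) auto
  have main: "(if h \<le> 1/5 then 5/2 else 25/28) * (\<nu> * \<beta>)\<^sup>2 <
      (\<mu> - \<nu> * h) * (2 * \<phi> - \<beta>) - 2 * \<phi> * ((1/2 + h)\<^sup>2 * (h - h\<^sup>2)) + 2 * c * (\<delta> / (1 - h) - 1)"
    unfolding \<phi>_def using A2_low[of h] A2_high[of h] assms by auto
  have "edge_val h r h \<beta> = (\<mu> - \<nu> * h) * (2 * \<phi> - \<beta>) - 2 * \<phi> * ((1/2 + h)\<^sup>2 * (h - h\<^sup>2))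
      - \<nu> * \<beta> * r - 2 * \<phi> * (1/4 + 2 * h\<^sup>2) * r\<^sup>2 + 2 * \<phi> * (r\<^sup>2)\<^sup>2 + deg_gain h r"
    unfolding edge_val_def Let_def \<phi>_def by algebra
  moreover have "0 \<le> 2 * \<phi> * (r\<^sup>2)\<^sup>2" using phi by simp
  ultimately show ?thesis
    using loss main deg_gain_ge[OF assms(1-3)] unfolding p_def left_diff_distrib by linarith
qed

text \<open>At \<open>f = 0\<close> the value grows with \<open>g\<close>, because
  \<open>h + r\<close> exceeds \<open>\<mu>\<close>, which is at least
  \<open>\<mu> - \<nu> * h + \<nu> * r\<close>. So only the least \<open>g\<close> matters:
  \<open>1 - 2 * h\<close> for \<open>h \<le> 1/2\<close>, and \<open>0\<close> beyond.\<close>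

lemma vertex_B:
  assumes "0 \<le> r" "r \<le> h" "h + r < 1" "1 - 2 * h \<le> g" "0 \<le> g" "g \<le> \<beta>"
  shows "0 < edge_val h r (g - (1 - 2 * h)) g"
proof -
  have h: "1/3 \<le> h" using assms params by linarith
  have h2: "1/9 \<le> h\<^sup>2" using power_mono[OF h, of 2] by (simp add: power2_eq_square)
  have val: "edge_val h r (g - (1 - 2 * h)) g =
      deg_gain h r - (\<mu> - \<nu> * h + \<nu> * r) * g - (h + r) * (\<beta> - g)"
    unfolding edge_val_def Let_def by (simp add: algebra_simps)
  have slope: "0 \<le> h + r - (\<mu> - \<nu> * h + \<nu> * r)"
  proof -
    have "\<nu> * r \<le> \<nu> * h" using assms params by (intro mult_left_mono) auto
    then show ?thesis using h params assms by linarith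
  qed
  show ?thesis
  proof (cases "h \<le> 1/2")
    case True
    have "(1 - 2 * h) * (h + r - (\<mu> - \<nu> * h + \<nu> * r)) \<le> g * (h + r - (\<mu> - \<nu> * h + \<nu> * r))"
      using assms slope by (intro mult_right_mono) auto
    then have "- (\<mu> - \<nu> * h) * (1 - 2 * h) - h * (\<beta> - 1 + 2 * h)
        - (\<nu> * (1 - 2 * h) + (\<beta> - 1 + 2 * h)) * r \<le>
        - (\<mu> - \<nu> * h + \<nu> * r) * g - (h + r) * (\<beta> - g)"
      by (simp add: algebra_simps)
    \<comment> \<open>By \<open>h \<ge> 1/3\<close> the coefficient of \<open>r\<^sup>2\<close> is
      at least \<open>32/25\<close>, above \<open>5/4\<close>; in the other case
      \<open>h > 1/2\<close> gives \<open>48/25\<close>, above \<open>7/4\<close>.\<close>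
    moreover have "- ((\<nu> * (1 - 2 * h) + (\<beta> - 1 + 2 * h))\<^sup>2 / (4 * (5/4))) \<le>
        12/25 * (1 + 3 * h + 6 * h\<^sup>2) * r\<^sup>2 - (\<nu> * (1 - 2 * h) + (\<beta> - 1 + 2 * h)) * r"
      using h h2 by (intro linear_quadratic_ge) auto
    moreover have "4 * (5/4) = (5::real)" by simp
    moreover have "(1 - \<beta>) / 2 \<le> h" using assms by simp
    note B_low[OF this True]
    ultimately show ?thesis
      using deg_gain_ge[OF assms(1-3)] unfolding val by (simp only:)
  next
    case False
    have "1/4 \<le> h\<^sup>2" using power_mono[of "1/2" h 2] False by (simp add: power2_eq_square)
    then have "- (\<beta>\<^sup>2 / (4 * (7/4))) \<le> 12/25 * (1 + 3 * h + 6 * h\<^sup>2) * r\<^sup>2 - \<beta> * r"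
      using False by (intro linear_quadratic_ge) auto
    moreover have "0 \<le> g * (h + r - (\<mu> - \<nu> * h + \<nu> * r))" using assms slope by simp
    then have "- h * \<beta> - \<beta> * r \<le> - (\<mu> - \<nu> * h + \<nu> * r) * g - (h + r) * (\<beta> - g)"
      by (simp add: algebra_simps)
    moreover have "4 * (7/4) = (7::real)" by simp
    moreover have "1/2 \<le> h" "h < 1" using assms False by simp_all
    note B_high[OF this]
    ultimately show ?thesis
      using deg_gain_ge[OF assms(1-3)] unfolding val by (simp only:)
  qed
qed

text \<open>At \<open>w = 0\<close> the covariance term has the favorable sign, since
  \<open>r \<le> h\<close>, and is dropped. Only the linear loss \<open>\<beta> * r\<close> must be
  absorbed.\<close>

lemma vertex_C1:
  assumes "0 \<le> r" "r \<le> h" "h + r < 1" "h \<le> 1/2"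
  shows "0 < edge_val h r 0 0"
proof -
  have "r\<^sup>2 \<le> (1/2 + h)\<^sup>2" "r\<^sup>2 \<le> h\<^sup>2" using assms by (auto intro!: power_mono)
  then have "0 \<le> 2 * (1 - 2 * h) * (((1/2 + h)\<^sup>2 - r\<^sup>2) * (h\<^sup>2 - r\<^sup>2))"
    using assms by simp
  also have "\<dots> = edge_val h r 0 0
      - (2 * (\<mu> - \<nu> * h) * (1 - 2 * h) - h * \<beta> - \<beta> * r + deg_gain h r)"
    unfolding edge_val_def Let_def by algebra
  finally have "2 * (\<mu> - \<nu> * h) * (1 - 2 * h) - h * \<beta> - \<beta> * r + deg_gain h r \<le> edge_val h r 0 0"
    by simp
  moreover have "- (\<beta>\<^sup>2 / (4 * (12/25))) \<le> 12/25 * (1 + 3 * h + 6 * h\<^sup>2) * r\<^sup>2 - \<beta> * r"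
    using assms by (intro linear_quadratic_ge) auto
  moreover have "\<beta>\<^sup>2 / (4 * (12/25)) = 25/48 * \<beta>\<^sup>2" by simp
  moreover have "0 \<le> h" using assms by simp
  note C1_low[OF this assms(4)]
  ultimately show ?thesis
    using deg_gain_ge[OF assms(1-3)] by (simp only:)
qed

text \<open>The value is at least \<open>P + L * r\<close>, where \<open>P\<close> is the value at
  \<open>r = 0\<close>. For \<open>h\<close> in the middle range \<open>L\<close> is nonnegative;
  for small and large \<open>h\<close> the bounds \<open>r \<le> h\<close> and
  \<open>r < 1 - h\<close> limit the damage.\<close>

lemma vertex_C2:
  assumes "0 \<le> r" "r \<le> h" "h + r < 1"
  shows "0 < edge_val h r (h - r) 0"
proof -
  define q where "q = 1/2 + 3/2 * h - 2 * h ^ 3"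
  define K where "K = 12/25 * (1 + 3 * h + 6 * h\<^sup>2)"
  define L where "L = q - 2 * (\<mu> - \<nu> * h) - \<beta> + (K - q) * r"
  define P where "P = 2 * (\<mu> - \<nu> * h) * (1 - h) - 2 * (1 - h)\<^sup>2 * (1/2 + h)\<^sup>2 * h - h * \<beta>
      + 2 * c * (\<delta> / (1 - h) - 1)"
  have h: "0 \<le> h" "h < 1" "0 \<le> r" "r < 1 - h" using assms by auto
  have q_eq: "q = 2 * (1/2 + h)\<^sup>2 * (1 - h)"
    unfolding q_def by algebra
  have q: "0 \<le> q" unfolding q_eq using h by simp
  have "- 1/40 \<le> K - q"
  proof -
    have "K - q = 72/25 * (h - 1/96)\<^sup>2 + 2 * h ^ 3 - 1/50 - 1/3200"
      unfolding K_def q_def by algebra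
    moreover have "0 \<le> 72/25 * (h - 1/96)\<^sup>2" "0 \<le> h ^ 3" using h by auto
    ultimately show ?thesis by linarith
  qed
  then have Kq: "- 1/40 * r \<le> (K - q) * r" using h by (intro mult_right_mono) auto
  have nh: "0 \<le> \<nu> * h" using params h by simp
  have "0 < P + L * r"
  proof (cases "h \<le> 1/5")
    case True
    have "h ^ 3 \<le> 1/25 * h"
      using h True mult_mono[of h "1/5" h "1/5"] mult_right_mono[of "h * h" "1/25" h]
      by (simp add: power3_eq_cube)
    then have "1/2 \<le> q" unfolding q_def using h by linarith
    then have "- 31/100 \<le> L"
      unfolding L_def right_diff_distrib using Kq nh params(9) True h(3) assms(2) by linarith
    then have "- 31/100 * r \<le> L * r" using h by (intro mult_right_mono) auto
    then show ?thesis using C2_low[OF h(1) True] assms h unfolding P_def by linarith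
  next
    case False
    show ?thesis
    proof (cases "h \<le> 3/4")
      case True
      \<comment> \<open>The factor \<open>h + 19/20\<close> cancels the square term; the product
        falls short of \<open>q - 39/50\<close> by \<open>(1 - h) / 200\<close>. As
        \<open>r \<le> 4/5\<close>, the term \<open>(K - q) * r\<close> loses at most
        \<open>1/50\<close>, which leaves the \<open>19/25\<close> of the assumptions.\<close>
      have "0 \<le> 2 * (h - 1/5) * (3/4 - h) * (h + 19/20)"
        using False True by (intro mult_nonneg_nonneg) auto
      then have "39/50 \<le> q"
        unfolding q_def using True by (simp add: power3_eq_cube algebra_simps)
      moreover have "1/5 * \<nu> \<le> \<nu> * h" using mult_right_mono[of "1/5" h \<nu>] False params by (simp add: mult.commute)
      moreover have "r \<le> 4/5" using False h by linarith
      ultimately have "0 \<le> L"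
        unfolding L_def right_diff_distrib using Kq params(10) by linarith
      then have "0 \<le> L * r" using h by simp
      moreover have "1/5 \<le> h" using False by simp
      note C2_mid[OF this True]
      ultimately show ?thesis unfolding P_def by linarith
    next
      case False
      have "- 83/100 \<le> L"
        unfolding L_def right_diff_distrib using Kq nh q params(9) h by linarith
      then have "- 83/100 * r \<le> L * r" using h by (intro mult_right_mono) auto
      moreover have "3/4 \<le> h" using False by simp
      note C2_high[OF this h(2), folded P_def]
      moreover have "83/100 * r \<le> 83/100 * (1 - h)" using h by simp
      ultimately show ?thesis by linarith
    qed
  qed
  also have "P + L * r \<le> edge_val h r (h - r) 0"
  proof -
    have "edge_val h r (h - r) 0 = 2 * (\<mu> - \<nu> * h) * (1 - h - r)
        - 2 * (1 - h - r)\<^sup>2 * ((1/2 + h)\<^sup>2 - r\<^sup>2) * (h - r) - (h + r) * \<beta> + deg_gain h r"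
      unfolding edge_val_def Let_def by algebra
    moreover have "2 * (1 - h - r)\<^sup>2 * ((1/2 + h)\<^sup>2 - r\<^sup>2) * (h - r) \<le>
        2 * (1 - h - r)\<^sup>2 * (1/2 + h)\<^sup>2 * (h - r)"
      using assms by (intro mult_right_mono mult_left_mono) auto
    moreover have "2 * (1 - h)\<^sup>2 * (1/2 + h)\<^sup>2 * h - 2 * (1 - h - r)\<^sup>2 * (1/2 + h)\<^sup>2 * (h - r)
        = q * (1 - r) * r + 2 * (1/2 + h)\<^sup>2 * (1 - h - r) * r * (h - r)"
      unfolding q_eq by algebra
    moreover have "0 \<le> 2 * (1/2 + h)\<^sup>2 * (1 - h - r) * r * (h - r)"
      using assms h by (intro mult_nonneg_nonneg) auto
    moreover have "L * r = q * (1 - r) * r - 2 * (\<mu> - \<nu> * h) * r - \<beta> * r + K * r\<^sup>2"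
      unfolding L_def by (simp add: power2_eq_square algebra_simps)
    ultimately show ?thesis
      using deg_gain_ge[OF assms] unfolding P_def K_def by (simp add: algebra_simps)
  qed
  finally show ?thesis .
qed

sublocale good_weights
  using params vertex_A1 vertex_A2 vertex_B vertex_C1 vertex_C2
  by unfold_locales auto

end

section \<open>Numerical certificates\<close>

lemma gain_pos:
  fixes h X e c \<delta> :: real
  assumes "h < 1" "e \<le> (1 - h) * X + c * (\<delta> - (1 - h))" "0 < e"
  shows "0 < X + c * (\<delta> / (1 - h) - 1)"
proof -
  have "(1 - h) * (X + c * (\<delta> / (1 - h) - 1)) = (1 - h) * X + c * (\<delta> - (1 - h))"
    using assms by (simp add: field_simps)
  then have "0 < (1 - h) * (X + c * (\<delta> / (1 - h) - 1))" using assms by linarith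
  then show ?thesis using assms by (simp add: zero_less_mult_iff)
qed

section \<open>Certificates for \<open>\<beta> = 1/3\<close>\<close>

text \<open>
  The weights were found by numerical optimization. After multiplication by \<open>1 - h\<close> every
  inequality concerns a polynomial on an interval \<open>[l, u]\<close>; the certificates expand it, minus
  \<open>1/5000\<close>, in the Bernstein basis \<open>(h - l)\<^sup>i (u - h)\<^sup>j\<close> with nonnegative coefficients.
\<close>

lemma third_A1_low:
  fixes h :: real
  assumes "0 \<le> h" "h \<le> 1/5"
  shows "0 < (21/100) * (2 * (1 - 1/3 - 2 * h) - 1/3) + 2 * (1 - 1/3 - 2 * h) * ((1/2 + h)\<^sup>2 * h\<^sup>2) + 33/50 * (369/500 / (1 - h) - 1)"
proof -
  have "(1 - h) * ((21/100) * (2 * (1 - 1/3 - 2 * h) - 1/3) + 2 * (1 - 1/3 - 2 * h) * ((1/2 + h)\<^sup>2 * h\<^sup>2)) + 33/50 * (369/500 - (1 - h)) =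
      1/5000 + (2305/4 * (1/5 - h) ^ 6 + 8955/4 * h * (1/5 - h) ^ 5 + 9850/3 * h ^ 2 * (1/5 - h) ^ 4
      + 13625/6 * h ^ 3 * (1/5 - h) ^ 3 + 3125/4 * h ^ 4 * (1/5 - h) ^ 2
      + 1685/12 * h ^ 5 * (1/5 - h) + 79/6 * h ^ 6)"
    by algebra
  also have "\<dots> \<ge> 1/5000"
    using assms by (simp add: add_nonneg_nonneg)
  finally show ?thesis
    by (rule gain_pos[rotated]) (use assms in auto)
qed

lemma third_A1_high:
  fixes h :: real
  assumes "1/5 \<le> h" "h \<le> 1/3"
  shows "0 < (21/100) * (2 * (1 - 1/3 - 2 * h) - 1/3) + 2 * (1 - 1/3 - 2 * h) * ((1/2 + h)\<^sup>2 * h\<^sup>2) + 33/50 * (369/500 / (1 - h) - 1)"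
proof -
  have "(1 - h) * ((21/100) * (2 * (1 - 1/3 - 2 * h) - 1/3) + 2 * (1 - 1/3 - 2 * h) * ((1/2 + h)\<^sup>2 * h\<^sup>2)) + 33/50 * (369/500 - (1 - h)) =
      1/5000 + (19197/128 * (1/3 - h) ^ 6 + 55485/128 * (h - 1/5) * (1/3 - h) ^ 5
      + 84375/64 * (h - 1/5) ^ 2 * (1/3 - h) ^ 4 + 190125/64 * (h - 1/5) ^ 3 * (1/3 - h) ^ 3
      + 381225/128 * (h - 1/5) ^ 4 * (1/3 - h) ^ 2 + 137785/128 * (h - 1/5) ^ 5 * (1/3 - h)
      + 1215/32 * (h - 1/5) ^ 6)"
    by algebra
  also have "\<dots> \<ge> 1/5000"
    using assms by (simp add: add_nonneg_nonneg)
  finally show ?thesis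
    by (rule gain_pos[rotated]) (use assms in auto)
qed

lemma third_A2_low:
  fixes h :: real
  assumes "0 \<le> h" "h \<le> 1/5"
  shows "0 < (21/100) * (2 * (1 - 1/3 - h) - 1/3) - 2 * (1 - 1/3 - h) * ((1/2 + h)\<^sup>2 * (h - h\<^sup>2)) + 33/50 * (369/500 / (1 - h) - 1)"
proof -
  have "(1 - h) * ((21/100) * (2 * (1 - 1/3 - h) - 1/3) - 2 * (1 - 1/3 - h) * ((1/2 + h)\<^sup>2 * (h - h\<^sup>2))) + 33/50 * (369/500 - (1 - h)) =
      1/5000 + (2305/4 * (1/5 - h) ^ 6 + 30115/12 * h * (1/5 - h) ^ 5 + 8125/2 * h ^ 2 * (1/5 - h) ^ 4
      + 17575/6 * h ^ 3 * (1/5 - h) ^ 3 + 10325/12 * h ^ 4 * (1/5 - h) ^ 2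
      + 305/4 * h ^ 5 * (1/5 - h) + 107/6 * h ^ 6)"
    by algebra
  also have "\<dots> \<ge> 1/5000"
    using assms by (simp add: add_nonneg_nonneg)
  finally show ?thesis
    by (rule gain_pos[rotated]) (use assms in auto)
qed

lemma third_A2_high:
  fixes h :: real
  assumes "1/5 \<le> h" "h \<le> 2/3"
  shows "0 < (21/100) * (2 * (1 - 1/3 - h) - 1/3) - 2 * (1 - 1/3 - h) * ((1/2 + h)\<^sup>2 * (h - h\<^sup>2)) + 33/50 * (369/500 / (1 - h) - 1)"
proof -
  have "(1 - h) * ((21/100) * (2 * (1 - 1/3 - h) - 1/3) - 2 * (1 - 1/3 - h) * ((1/2 + h)\<^sup>2 * (h - h\<^sup>2))) + 33/50 * (369/500 - (1 - h)) =
      1/5000 + (26001/235298 * (2/3 - h) ^ 6 + 521235/470596 * (h - 1/5) * (2/3 - h) ^ 5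
      + 13680225/470596 * (h - 1/5) ^ 2 * (2/3 - h) ^ 4
      + 27249975/235298 * (h - 1/5) ^ 3 * (2/3 - h) ^ 3
      + 40440375/235298 * (h - 1/5) ^ 4 * (2/3 - h) ^ 2
      + 49747195/470596 * (h - 1/5) ^ 5 * (2/3 - h) + 11096595/470596 * (h - 1/5) ^ 6)"
    by algebra
  also have "\<dots> \<ge> 1/5000"
    using assms by (simp add: add_nonneg_nonneg)
  finally show ?thesis
    by (rule gain_pos[rotated]) (use assms in auto)
qed

lemma third_B_low:
  fixes h :: real
  assumes "1/3 \<le> h" "h \<le> 1/2"
  shows "0 < - ((21/100) * (1 - 2 * h)) - h * (1/3 - 1 + 2 * h) - (1/3 - 1 + 2 * h)\<^sup>2 / 5 + 33/50 * (369/500 / (1 - h) - 1)"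
proof -
  have "(1 - h) * (- ((21/100) * (1 - 2 * h)) - h * (1/3 - 1 + 2 * h) - (1/3 - 1 + 2 * h)\<^sup>2 / 5) + 33/50 * (369/500 - (1 - h)) =
      1/5000 + (144/3125 * (1/2 - h) ^ 3 + 64057/3125 * (h - 1/3) * (1/2 - h) ^ 2
      + 97307/3125 * (h - 1/3) ^ 2 * (1/2 - h) + 42144/3125 * (h - 1/3) ^ 3)"
    by algebra
  also have "\<dots> \<ge> 1/5000"
    using assms by (simp add: add_nonneg_nonneg)
  finally show ?thesis
    by (rule gain_pos[rotated]) (use assms in auto)
qed

lemma third_B_high:
  fixes h :: real
  assumes "1/2 \<le> h" "h < 1"
  shows "0 < - (h * 1/3) - (1/3)\<^sup>2 / 7 + 33/50 * (369/500 / (1 - h) - 1)"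
proof -
  have "(1 - h) * (- (h * 1/3) - (1/3)\<^sup>2 / 7) + 33/50 * (369/500 - (1 - h)) =
      1/5000 + (51668/196875 * (1 - h) ^ 2 + 369461/196875 * (h - 1/2) * (1 - h)
      + 6086/3125 * (h - 1/2) ^ 2)"
    by algebra
  also have "\<dots> \<ge> 1/5000"
    using assms by (simp add: add_nonneg_nonneg)
  finally show ?thesis
    by (rule gain_pos[rotated]) (use assms in auto)
qed

lemma third_C1_low:
  fixes h :: real
  assumes "0 \<le> h" "h \<le> 1/2"
  shows "0 < 2 * (21/100) * (1 - 2 * h) - h * 1/3 - 25/48 * (1/3)\<^sup>2 + 33/50 * (369/500 / (1 - h) - 1)"
proof -
  have "(1/5000::real) \<le> (1 - h) * (2 * (21/100) * (1 - 2 * h) - h * 1/3 - 25/48 * (1/3)\<^sup>2) + 33/50 * (369/500 - (1 - h))" (is "_ \<le> ?p")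
  proof -
    \<comment> \<open>On the whole interval the middle Bernstein coefficient of this quadratic is
      negative, hence the bisection.\<close>
    consider "0 \<le> h" "h \<le> 1/4" | "1/4 \<le> h" "h \<le> 1/2"
      using assms by linarith
    then show ?thesis
    proof cases
      case 1
      have "?p = 1/5000 + (255163/84375 * (1/4 - h) ^ 2 + 859429/337500 * h * (1/4 - h) + 78259/112500 * h ^ 2)"
        by algebra
      also have "\<dots> \<ge> 1/5000"
        using 1 by (simp add: add_nonneg_nonneg)
      finally show ?thesis .
    next
      case 2
      have "?p = 1/5000 + (78259/112500 * (1/2 - h) ^ 2 + 79679/337500 * (h - 1/4) * (1/2 - h)
        + 120451/168750 * (h - 1/4) ^ 2)"
        by algebra
      also have "\<dots> \<ge> 1/5000"
        using 2 by (simp add: add_nonneg_nonneg)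
      finally show ?thesis .
    qed
  qed
  then show ?thesis
    by (rule gain_pos[rotated]) (use assms in auto)
qed

lemma third_C2_low:
  fixes h :: real
  assumes "0 \<le> h" "h \<le> 1/5"
  shows "0 < 2 * (21/100) * (1 - h) - 2 * (1 - h)\<^sup>2 * (1/2 + h)\<^sup>2 * h - h * 1/3 - 31/100 * h + 33/50 * (369/500 / (1 - h) - 1)"
proof -
  have "(1 - h) * (2 * (21/100) * (1 - h) - 2 * (1 - h)\<^sup>2 * (1/2 + h)\<^sup>2 * h - h * 1/3 - 31/100 * h) + 33/50 * (369/500 - (1 - h)) =
      1/5000 + (7715/2 * (1/5 - h) ^ 6 + 228115/12 * h * (1/5 - h) ^ 5 + 75075/2 * h ^ 2 * (1/5 - h) ^ 4
      + 112550/3 * h ^ 3 * (1/5 - h) ^ 3 + 117425/6 * h ^ 4 * (1/5 - h) ^ 2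
      + 19275/4 * h ^ 5 * (1/5 - h) + 2287/6 * h ^ 6)"
    by algebra
  also have "\<dots> \<ge> 1/5000"
    using assms by (simp add: add_nonneg_nonneg)
  finally show ?thesis
    by (rule gain_pos[rotated]) (use assms in auto)
qed

lemma third_C2_mid:
  fixes h :: real
  assumes "1/5 \<le> h" "h \<le> 3/4"
  shows "0 < 2 * (21/100) * (1 - h) - 2 * (1 - h)\<^sup>2 * (1/2 + h)\<^sup>2 * h - h * 1/3 + 33/50 * (369/500 / (1 - h) - 1)"
proof -
  have "(1/5000::real) \<le> (1 - h) * (2 * (21/100) * (1 - h) - 2 * (1 - h)\<^sup>2 * (1/2 + h)\<^sup>2 * h - h * 1/3) + 33/50 * (369/500 - (1 - h))" (is "_ \<le> ?p")
  proof -
    consider "1/5 \<le> h" "h \<le> 19/40" | "19/40 \<le> h" "h \<le> 3/4"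
      using assms by linarith
    then show ?thesis
    proof cases
      case 1
      have "?p = 1/5000 + (909246464/5314683 * (19/40 - h) ^ 6 + 1115439104/1771561 * (h - 1/5) * (19/40 - h) ^ 5
        + 4580976640/5314683 * (h - 1/5) ^ 2 * (19/40 - h) ^ 4
        + 3459656960/5314683 * (h - 1/5) ^ 3 * (19/40 - h) ^ 3
        + 851983520/1771561 * (h - 1/5) ^ 4 * (19/40 - h) ^ 2
        + 1749807232/5314683 * (h - 1/5) ^ 5 * (19/40 - h) + 173412402/1771561 * (h - 1/5) ^ 6)"
        by algebra
      also have "\<dots> \<ge> 1/5000"
        using 1 by (simp add: add_nonneg_nonneg)
      finally show ?thesis .
    next
      case 2
      have "?p = 1/5000 + (173412402/1771561 * (3/4 - h) ^ 6 + 4493039240/5314683 * (h - 19/40) * (3/4 - h) ^ 5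
        + 16272110600/5314683 * (h - 19/40) ^ 2 * (3/4 - h) ^ 4
        + 10077870400/1771561 * (h - 19/40) ^ 3 * (3/4 - h) ^ 3
        + 30038199200/5314683 * (h - 19/40) ^ 4 * (3/4 - h) ^ 2
        + 15153088640/5314683 * (h - 19/40) ^ 5 * (3/4 - h)
        + 1019940480/1771561 * (h - 19/40) ^ 6)"
        by algebra
      also have "\<dots> \<ge> 1/5000"
        using 2 by (simp add: add_nonneg_nonneg)
      finally show ?thesis .
    qed
  qed
  then show ?thesis
    by (rule gain_pos[rotated]) (use assms in auto)
qed

lemma third_C2_high:
  fixes h :: real
  assumes "3/4 \<le> h" "h < 1"
  shows "0 < 2 * (21/100) * (1 - h) - 2 * (1 - h)\<^sup>2 * (1/2 + h)\<^sup>2 * h - h * 1/3 - 83/100 * (1 - h) + 33/50 * (369/500 / (1 - h) - 1)"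
proof -
  have "(1 - h) * (2 * (21/100) * (1 - h) - 2 * (1 - h)\<^sup>2 * (1/2 + h)\<^sup>2 * h - h * 1/3 - 83/100 * (1 - h)) + 33/50 * (369/500 - (1 - h)) =
      1/5000 + (2523314/3125 * (1 - h) ^ 6 + 58511152/9375 * (h - 3/4) * (1 - h) ^ 5
      + 35490776/1875 * (h - 3/4) ^ 2 * (1 - h) ^ 4
      + 18341856/625 * (h - 3/4) ^ 3 * (1 - h) ^ 3
      + 46515776/1875 * (h - 3/4) ^ 4 * (1 - h) ^ 2
      + 102641152/9375 * (h - 3/4) ^ 5 * (1 - h) + 6232064/3125 * (h - 3/4) ^ 6)"
    by algebra
  also have "\<dots> \<ge> 1/5000"
    using assms by (simp add: add_nonneg_nonneg)
  finally show ?thesis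
    by (rule gain_pos[rotated]) (use assms in auto)
qed

section \<open>Certificates for \<open>\<beta> = 1/4\<close>\<close>

lemma quarter_A1_low:
  fixes h :: real
  assumes "0 \<le> h" "h \<le> 1/5"
  shows "0 < (27/100 - 1/10 * h) * (2 * (1 - 1/4 - 2 * h) - 1/4) + 2 * (1 - 1/4 - 2 * h) * ((1/2 + h)\<^sup>2 * h\<^sup>2) - 5/2 * (1/10 * 1/4)\<^sup>2 + 189/250 * (337/500 / (1 - h) - 1)"
proof -
  have "(1 - h) * ((27/100 - 1/10 * h) * (2 * (1 - 1/4 - 2 * h) - 1/4) + 2 * (1 - 1/4 - 2 * h) * ((1/2 + h)\<^sup>2 * h\<^sup>2) - 5/2 * (1/10 * 1/4)\<^sup>2) + 189/250 * (337/500 - (1 - h)) =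
      1/5000 + (178563/128 * (1/5 - h) ^ 6 + 757403/128 * h * (1/5 - h) ^ 5
      + 633485/64 * h ^ 2 * (1/5 - h) ^ 4 + 530355/64 * h ^ 3 * (1/5 - h) ^ 3
      + 466295/128 * h ^ 4 * (1/5 - h) ^ 2 + 101743/128 * h ^ 5 * (1/5 - h) + 2135/32 * h ^ 6)"
    by algebra
  also have "\<dots> \<ge> 1/5000"
    using assms by (simp add: add_nonneg_nonneg)
  finally show ?thesis
    by (rule gain_pos[rotated]) (use assms in auto)
qed

lemma quarter_A1_high:
  fixes h :: real
  assumes "1/5 \<le> h" "h \<le> 3/8"
  shows "0 < (27/100 - 1/10 * h) * (2 * (1 - 1/4 - 2 * h) - 1/4) + 2 * (1 - 1/4 - 2 * h) * ((1/2 + h)\<^sup>2 * h\<^sup>2) - 25/28 * (1/10 * 1/4)\<^sup>2 + 189/250 * (337/500 / (1 - h) - 1)"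
proof -
  have "(1/5000::real) \<le> (1 - h) * ((27/100 - 1/10 * h) * (2 * (1 - 1/4 - 2 * h) - 1/4) + 2 * (1 - 1/4 - 2 * h) * ((1/2 + h)\<^sup>2 * h\<^sup>2) - 25/28 * (1/10 * 1/4)\<^sup>2) + 189/250 * (337/500 - (1 - h))" (is "_ \<le> ?p")
  proof -
    consider "1/5 \<le> h" "h \<le> 23/80" | "23/80 \<le> h" "h \<le> 3/8"
      using assms by linarith
    then show ?thesis
    proof cases
      case 1
      have "?p = 1/5000 + (9310044160/823543 * (23/80 - h) ^ 6 + 35426676736/823543 * (h - 1/5) * (23/80 - h) ^ 5
        + 52529500160/823543 * (h - 1/5) ^ 2 * (23/80 - h) ^ 4
        + 38812879360/823543 * (h - 1/5) ^ 3 * (23/80 - h) ^ 3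
        + 15651856000/823543 * (h - 1/5) ^ 4 * (23/80 - h) ^ 2
        + 3741015176/823543 * (h - 1/5) ^ 5 * (23/80 - h) + 492465124/823543 * (h - 1/5) ^ 6)"
        by algebra
      also have "\<dots> \<ge> 1/5000"
        using 1 by (simp add: add_nonneg_nonneg)
      finally show ?thesis .
    next
      case 2
      have "?p = 1/5000 + (492465124/823543 * (3/8 - h) ^ 6 + 2168566312/823543 * (h - 23/80) * (3/8 - h) ^ 5
        + 7789611680/823543 * (h - 23/80) ^ 2 * (3/8 - h) ^ 4
        + 15555781440/823543 * (h - 23/80) ^ 3 * (3/8 - h) ^ 3
        + 14207183680/823543 * (h - 23/80) ^ 4 * (3/8 - h) ^ 2
        + 5068253312/823543 * (h - 23/80) ^ 5 * (3/8 - h) + 306634752/823543 * (h - 23/80) ^ 6)"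
        by algebra
      also have "\<dots> \<ge> 1/5000"
        using 2 by (simp add: add_nonneg_nonneg)
      finally show ?thesis .
    qed
  qed
  then show ?thesis
    by (rule gain_pos[rotated]) (use assms in auto)
qed

lemma quarter_A2_low:
  fixes h :: real
  assumes "0 \<le> h" "h \<le> 1/5"
  shows "0 < (27/100 - 1/10 * h) * (2 * (1 - 1/4 - h) - 1/4) - 2 * (1 - 1/4 - h) * ((1/2 + h)\<^sup>2 * (h - h\<^sup>2)) - 5/2 * (1/10 * 1/4)\<^sup>2 + 189/250 * (337/500 / (1 - h) - 1)"
proof -
  have "(1 - h) * ((27/100 - 1/10 * h) * (2 * (1 - 1/4 - h) - 1/4) - 2 * (1 - 1/4 - h) * ((1/2 + h)\<^sup>2 * (h - h\<^sup>2)) - 5/2 * (1/10 * 1/4)\<^sup>2) + 189/250 * (337/500 - (1 - h)) =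
      1/5000 + (178563/128 * (1/5 - h) ^ 6 + 823403/128 * h * (1/5 - h) ^ 5
      + 743885/64 * h ^ 2 * (1/5 - h) ^ 4 + 659555/64 * h ^ 3 * (1/5 - h) ^ 3
      + 586295/128 * h ^ 4 * (1/5 - h) ^ 2 + 118463/128 * h ^ 5 * (1/5 - h) + 2151/32 * h ^ 6)"
    by algebra
  also have "\<dots> \<ge> 1/5000"
    using assms by (simp add: add_nonneg_nonneg)
  finally show ?thesis
    by (rule gain_pos[rotated]) (use assms in auto)
qed

lemma quarter_A2_high:
  fixes h :: real
  assumes "1/5 \<le> h" "h \<le> 3/4"
  shows "0 < (27/100 - 1/10 * h) * (2 * (1 - 1/4 - h) - 1/4) - 2 * (1 - 1/4 - h) * ((1/2 + h)\<^sup>2 * (h - h\<^sup>2)) - 25/28 * (1/10 * 1/4)\<^sup>2 + 189/250 * (337/500 / (1 - h) - 1)"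
proof -
  have "(1/5000::real) \<le> (1 - h) * ((27/100 - 1/10 * h) * (2 * (1 - 1/4 - h) - 1/4) - 2 * (1 - 1/4 - h) * ((1/2 + h)\<^sup>2 * (h - h\<^sup>2)) - 25/28 * (1/10 * 1/4)\<^sup>2) + 189/250 * (337/500 - (1 - h))" (is "_ \<le> ?p")
  proof -
    \<comment> \<open>Bisection, repeated towards the left: near \<open>43/160\<close> the
      polynomial is only about \<open>1/800\<close>.\<close>
    consider "1/5 \<le> h" "h \<le> 43/160" | "43/160 \<le> h" "h \<le> 27/80" | "27/80 \<le> h" "h \<le> 19/40" | "19/40 \<le> h" "h \<le> 3/4"
      using assms by linarith
    then show ?thesis
    proof cases
      case 1
      have "?p = 1/5000 + (54509174784/1127357 * (43/160 - h) ^ 6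
        + 203667668992/1127357 * (h - 1/5) * (43/160 - h) ^ 5
        + 278312386560/1127357 * (h - 1/5) ^ 2 * (43/160 - h) ^ 4
        + 24241131520/161051 * (h - 1/5) ^ 3 * (43/160 - h) ^ 3
        + 57679925760/1127357 * (h - 1/5) ^ 4 * (43/160 - h) ^ 2
        + 28244301872/1127357 * (h - 1/5) ^ 5 * (43/160 - h)
        + 11100659114/1127357 * (h - 1/5) ^ 6)"
        by algebra
      also have "\<dots> \<ge> 1/5000"
        using 1 by (simp add: add_nonneg_nonneg)
      finally show ?thesis .
    next
      case 2
      have "?p = 1/5000 + (11100659114/1127357 * (27/80 - h) ^ 6
        + 9542146136/102487 * (h - 43/160) * (27/80 - h) ^ 5
        + 441276453880/1127357 * (h - 43/160) ^ 2 * (27/80 - h) ^ 4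
        + 938084868800/1127357 * (h - 43/160) ^ 3 * (27/80 - h) ^ 3
        + 149873874080/161051 * (h - 43/160) ^ 4 * (27/80 - h) ^ 2
        + 590866854016/1127357 * (h - 43/160) ^ 5 * (27/80 - h)
        + 132423353472/1127357 * (h - 43/160) ^ 6)"
        by algebra
      also have "\<dots> \<ge> 1/5000"
        using 2 by (simp add: add_nonneg_nonneg)
      finally show ?thesis .
    next
      case 3
      have "?p = 1/5000 + (2069114898/1127357 * (19/40 - h) ^ 6
        + 18779478976/1127357 * (h - 27/80) * (19/40 - h) ^ 5
        + 67931493320/1127357 * (h - 27/80) ^ 2 * (19/40 - h) ^ 4
        + 11371477120/102487 * (h - 27/80) ^ 3 * (19/40 - h) ^ 3
        + 124279431520/1127357 * (h - 27/80) ^ 4 * (19/40 - h) ^ 2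
        + 63547895296/1127357 * (h - 27/80) ^ 5 * (19/40 - h)
        + 1876548224/161051 * (h - 27/80) ^ 6)"
        by algebra
      also have "\<dots> \<ge> 1/5000"
        using 3 by (simp add: add_nonneg_nonneg)
      finally show ?thesis .
    next
      case 4
      have "?p = 1/5000 + (29321066/161051 * (3/4 - h) ^ 6 + 1708582588/1127357 * (h - 19/40) * (3/4 - h) ^ 5
        + 5687795920/1127357 * (h - 19/40) ^ 2 * (3/4 - h) ^ 4
        + 9678966560/1127357 * (h - 19/40) ^ 3 * (3/4 - h) ^ 3
        + 808565920/102487 * (h - 19/40) ^ 4 * (3/4 - h) ^ 2
        + 4200324928/1127357 * (h - 19/40) ^ 5 * (3/4 - h)
        + 802860288/1127357 * (h - 19/40) ^ 6)"
        by algebra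
      also have "\<dots> \<ge> 1/5000"
        using 4 by (simp add: add_nonneg_nonneg)
      finally show ?thesis .
    qed
  qed
  then show ?thesis
    by (rule gain_pos[rotated]) (use assms in auto)
qed

lemma quarter_B_low:
  fixes h :: real
  assumes "3/8 \<le> h" "h \<le> 1/2"
  shows "0 < - ((27/100 - 1/10 * h) * (1 - 2 * h)) - h * (1/4 - 1 + 2 * h) - (1/10 * (1 - 2 * h) + (1/4 - 1 + 2 * h))\<^sup>2 / 5 + 189/250 * (337/500 / (1 - h) - 1)"
proof -
  have "(1 - h) * (- ((27/100 - 1/10 * h) * (1 - 2 * h)) - h * (1/4 - 1 + 2 * h) - (1/10 * (1 - 2 * h) + (1/4 - 1 + 2 * h))\<^sup>2 / 5) + 189/250 * (337/500 - (1 - h)) =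
      1/5000 + (3502/15625 * (1/2 - h) ^ 3 + 651006/15625 * (h - 3/8) * (1/2 - h) ^ 2
      + 1103756/15625 * (h - 3/8) ^ 2 * (1/2 - h) + 500752/15625 * (h - 3/8) ^ 3)"
    by algebra
  also have "\<dots> \<ge> 1/5000"
    using assms by (simp add: add_nonneg_nonneg)
  finally show ?thesis
    by (rule gain_pos[rotated]) (use assms in auto)
qed

lemma quarter_B_high:
  fixes h :: real
  assumes "1/2 \<le> h" "h < 1"
  shows "0 < - (h * 1/4) - (1/4)\<^sup>2 / 7 + 189/250 * (337/500 / (1 - h) - 1)"
proof -
  have "(1 - h) * (- (h * 1/4) - (1/4)\<^sup>2 / 7) + 189/250 * (337/500 - (1 - h)) =
      1/5000 + (225329/875000 * (1 - h) ^ 2 + 1789283/875000 * (h - 1/2) * (1 - h)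
      + 31834/15625 * (h - 1/2) ^ 2)"
    by algebra
  also have "\<dots> \<ge> 1/5000"
    using assms by (simp add: add_nonneg_nonneg)
  finally show ?thesis
    by (rule gain_pos[rotated]) (use assms in auto)
qed

lemma quarter_C1_low:
  fixes h :: real
  assumes "0 \<le> h" "h \<le> 1/2"
  shows "0 < 2 * (27/100 - 1/10 * h) * (1 - 2 * h) - h * 1/4 - 25/48 * (1/4)\<^sup>2 + 189/250 * (337/500 / (1 - h) - 1)"
proof -
  have "(1/5000::real) \<le> (1 - h) * (2 * (27/100 - 1/10 * h) * (1 - 2 * h) - h * 1/4 - 25/48 * (1/4)\<^sup>2) + 189/250 * (337/500 - (1 - h))" (is "_ \<le> ?p")
  proof -
    consider "0 \<le> h" "h \<le> 1/4" | "1/4 \<le> h" "h \<le> 1/2"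
      using assms by linarith
    then show ?thesis
    proof cases
      case 1
      have "?p = 1/5000 + (3129503/187500 * (1/4 - h) ^ 3 + 22176661/750000 * h * (1/4 - h) ^ 2
        + 6294643/375000 * h ^ 2 * (1/4 - h) + 876879/250000 * h ^ 3)"
        by algebra
      also have "\<dots> \<ge> 1/5000"
        using 1 by (simp add: add_nonneg_nonneg)
      finally show ?thesis .
    next
      case 2
      have "?p = 1/5000 + (876879/250000 * (1/2 - h) ^ 3 + 399317/93750 * (h - 1/4) * (1/2 - h) ^ 2
        + 3387161/750000 * (h - 1/4) ^ 2 * (1/2 - h) + 1261631/375000 * (h - 1/4) ^ 3)"
        by algebra
      also have "\<dots> \<ge> 1/5000"
        using 2 by (simp add: add_nonneg_nonneg)
      finally show ?thesis .
    qed
  qed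
  then show ?thesis
    by (rule gain_pos[rotated]) (use assms in auto)
qed

lemma quarter_C2_low:
  fixes h :: real
  assumes "0 \<le> h" "h \<le> 1/5"
  shows "0 < 2 * (27/100 - 1/10 * h) * (1 - h) - 2 * (1 - h)\<^sup>2 * (1/2 + h)\<^sup>2 * h - h * 1/4 - 31/100 * h + 189/250 * (337/500 / (1 - h) - 1)"
proof -
  have "(1 - h) * (2 * (27/100 - 1/10 * h) * (1 - h) - 2 * (1 - h)\<^sup>2 * (1/2 + h)\<^sup>2 * h - h * 1/4 - 31/100 * h) + 189/250 * (337/500 - (1 - h)) =
      1/5000 + (9167/2 * (1/5 - h) ^ 6 + 22551 * h * (1/5 - h) ^ 5 + 89255/2 * h ^ 2 * (1/5 - h) ^ 4
      + 89915/2 * h ^ 3 * (1/5 - h) ^ 3 + 47755/2 * h ^ 4 * (1/5 - h) ^ 2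
      + 12237/2 * h ^ 5 * (1/5 - h) + 1081/2 * h ^ 6)"
    by algebra
  also have "\<dots> \<ge> 1/5000"
    using assms by (simp add: add_nonneg_nonneg)
  finally show ?thesis
    by (rule gain_pos[rotated]) (use assms in auto)
qed

lemma quarter_C2_mid:
  fixes h :: real
  assumes "1/5 \<le> h" "h \<le> 3/4"
  shows "0 < 2 * (27/100 - 1/10 * h) * (1 - h) - 2 * (1 - h)\<^sup>2 * (1/2 + h)\<^sup>2 * h - h * 1/4 + 189/250 * (337/500 / (1 - h) - 1)"
proof -
  have "(1/5000::real) \<le> (1 - h) * (2 * (27/100 - 1/10 * h) * (1 - h) - 2 * (1 - h)\<^sup>2 * (1/2 + h)\<^sup>2 * h - h * 1/4) + 189/250 * (337/500 - (1 - h))" (is "_ \<le> ?p")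
  proof -
    consider "1/5 \<le> h" "h \<le> 19/40" | "19/40 \<le> h" "h \<le> 3/4"
      using assms by linarith
    then show ?thesis
    proof cases
      case 1
      have "?p = 1/5000 + (344850432/1771561 * (19/40 - h) ^ 6 + 1242144768/1771561 * (h - 1/5) * (19/40 - h) ^ 5
        + 1632087040/1771561 * (h - 1/5) ^ 2 * (19/40 - h) ^ 4
        + 1124870400/1771561 * (h - 1/5) ^ 3 * (19/40 - h) ^ 3
        + 776901280/1771561 * (h - 1/5) ^ 4 * (19/40 - h) ^ 2
        + 555611008/1771561 * (h - 1/5) ^ 5 * (19/40 - h) + 172330546/1771561 * (h - 1/5) ^ 6)"
        by algebra
      also have "\<dots> \<ge> 1/5000"
        using 1 by (simp add: add_nonneg_nonneg)
      finally show ?thesis .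
    next
      case 2
      have "?p = 1/5000 + (172330546/1771561 * (3/4 - h) ^ 6 + 1512355544/1771561 * (h - 19/40) * (3/4 - h) ^ 5
        + 5560623960/1771561 * (h - 19/40) ^ 2 * (3/4 - h) ^ 4
        + 10438786880/1771561 * (h - 19/40) ^ 3 * (3/4 - h) ^ 3
        + 10438945760/1771561 * (h - 19/40) ^ 4 * (3/4 - h) ^ 2
        + 5287183744/1771561 * (h - 19/40) ^ 5 * (3/4 - h)
        + 1069969024/1771561 * (h - 19/40) ^ 6)"
        by algebra
      also have "\<dots> \<ge> 1/5000"
        using 2 by (simp add: add_nonneg_nonneg)
      finally show ?thesis .
    qed
  qed
  then show ?thesis
    by (rule gain_pos[rotated]) (use assms in auto)
qed

lemma quarter_C2_high:
  fixes h :: real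
  assumes "3/4 \<le> h" "h < 1"
  shows "0 < 2 * (27/100 - 1/10 * h) * (1 - h) - 2 * (1 - h)\<^sup>2 * (1/2 + h)\<^sup>2 * h - h * 1/4 - 83/100 * (1 - h) + 189/250 * (337/500 / (1 - h) - 1)"
proof -
  have "(1 - h) * (2 * (27/100 - 1/10 * h) * (1 - h) - 2 * (1 - h)\<^sup>2 * (1/2 + h)\<^sup>2 * h - h * 1/4 - 83/100 * (1 - h)) + 189/250 * (337/500 - (1 - h)) =
      1/5000 + (13398266/15625 * (1 - h) ^ 6 + 103118096/15625 * (h - 3/4) * (1 - h) ^ 5
      + 62395048/3125 * (h - 3/4) ^ 2 * (1 - h) ^ 4
      + 96572064/3125 * (h - 3/4) ^ 3 * (1 - h) ^ 3
      + 81506048/3125 * (h - 3/4) ^ 4 * (1 - h) ^ 2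
      + 179492096/15625 * (h - 3/4) ^ 5 * (1 - h) + 32598016/15625 * (h - 3/4) ^ 6)"
    by algebra
  also have "\<dots> \<ge> 1/5000"
    using assms by (simp add: add_nonneg_nonneg)
  finally show ?thesis
    by (rule gain_pos[rotated]) (use assms in auto)
qed

text \<open>\<open>\<delta> = 369/500\<close> is just below
  \<open>2 * \<alpha> * \<beta> = 2.2154 / 3\<close>. As \<open>\<nu> = 0\<close>, the losses
  \<open>(\<nu> * \<beta>)\<^sup>2\<close> vanish from the certificates, and their factor
  \<open>33/50\<close> is \<open>2 * c\<close>.\<close>

interpretation third: univariate_weights "1/3" "369/500" "21/100" "0" "33/100"
proof (unfold_locales, goal_cases)
  case (11 h)
  then show ?case using third_A1_low[of h] by (simp add: algebra_simps)
next
  case (12 h)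
  then show ?case using third_A1_high[of h] by (simp add: algebra_simps)
next
  case (13 h)
  then show ?case using third_A2_low[of h] by (simp add: algebra_simps)
next
  case (14 h)
  then show ?case using third_A2_high[of h] by (simp add: algebra_simps)
next
  case (15 h)
  then show ?case using third_B_low[of h] by (simp add: algebra_simps)
next
  case (16 h)
  then show ?case using third_B_high[of h] by (simp add: algebra_simps)
next
  case (17 h)
  then show ?case using third_C1_low[of h] by (simp add: algebra_simps)
next
  case (18 h)
  then show ?case using third_C2_low[of h] by (simp add: algebra_simps)
next
  case (19 h)
  then show ?case using third_C2_mid[of h] by (simp add: algebra_simps)
next
  case (20 h)
  then show ?case using third_C2_high[of h] by (simp add: algebra_simps)
qed auto

text \<open>Here \<open>\<delta> = 0.674\<close> is just below
  \<open>2 * \<alpha> * \<beta> = 0.67405\<close>.\<close>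

interpretation quarter: univariate_weights "1/4" "337/500" "27/100" "1/10" "189/500"
proof (unfold_locales, goal_cases)
  case (11 h)
  then show ?case using quarter_A1_low[of h] by (simp add: algebra_simps)
next
  case (12 h)
  then show ?case using quarter_A1_high[of h] by (simp add: algebra_simps)
next
  case (13 h)
  then show ?case using quarter_A2_low[of h] by (simp add: algebra_simps)
next
  case (14 h)
  then show ?case using quarter_A2_high[of h] by (simp add: algebra_simps)
next
  case (15 h)
  then show ?case using quarter_B_low[of h] by (simp add: algebra_simps)
next
  case (16 h)
  then show ?case using quarter_B_high[of h] by (simp add: algebra_simps)
next
  case (17 h)
  then show ?case using quarter_C1_low[of h] by (simp add: algebra_simps)
next
  case (18 h)
  then show ?case using quarter_C2_low[of h] by (simp add: algebra_simps)
next
  case (19 h)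
  then show ?case using quarter_C2_mid[of h] by (simp add: algebra_simps)
next
  case (20 h)
  then show ?case using quarter_C2_high[of h] by (simp add: algebra_simps)
qed auto

section \<open>Counting in graphs without rainbow triangles\<close>

text \<open>Grouping the elements by their value under \<open>\<phi>\<close> turns the double sum
  into a sum of squares.\<close>

lemma sum_same_value_products_nonneg:
  fixes y :: "'a \<Rightarrow> real"
  assumes "finite S"
  shows "0 \<le> (\<Sum>u\<in>S. \<Sum>v\<in>S. of_bool (\<phi> u = \<phi> v) * (y u * y v))"
proof -
  have "(\<Sum>u\<in>S. \<Sum>v\<in>S. of_bool (\<phi> u = \<phi> v) * (y u * y v)) =
      (\<Sum>u\<in>S. \<Sum>v\<in>S. \<Sum>i\<in>\<phi> ` S. of_bool (\<phi> u = i) * y u * (of_bool (\<phi> v = i) * y v))"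
  proof (intro sum.cong refl)
    fix u v assume "u \<in> S" "v \<in> S"
    have "(\<Sum>i\<in>\<phi> ` S. of_bool (\<phi> u = i) * y u * (of_bool (\<phi> v = i) * y v)) =
        (\<Sum>i\<in>\<phi> ` S. if i = \<phi> u then of_bool (\<phi> u = \<phi> v) * (y u * y v) else 0)"
      by (intro sum.cong) auto
    then show "of_bool (\<phi> u = \<phi> v) * (y u * y v) =
        (\<Sum>i\<in>\<phi> ` S. of_bool (\<phi> u = i) * y u * (of_bool (\<phi> v = i) * y v))"
      using assms \<open>u \<in> S\<close> by simp
  qed
  also have "\<dots> = (\<Sum>u\<in>S. \<Sum>i\<in>\<phi> ` S. \<Sum>v\<in>S. of_bool (\<phi> u = i) * y u * (of_bool (\<phi> v = i) * y v))"
    by (rule sum.cong[OF refl], rule sum.swap)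
  also have "\<dots> = (\<Sum>i\<in>\<phi> ` S. \<Sum>u\<in>S. \<Sum>v\<in>S. of_bool (\<phi> u = i) * y u * (of_bool (\<phi> v = i) * y v))"
    by (rule sum.swap)
  also have "\<dots> = (\<Sum>i\<in>\<phi> ` S. (\<Sum>u\<in>S. of_bool (\<phi> u = i) * y u)\<^sup>2)"
    unfolding power2_eq_square sum_product ..
  also have "\<dots> \<ge> 0" by (intro sum_nonneg) auto
  finally show ?thesis .
qed

text \<open>\<open>k\<close> will be the size of the trimmed classes. Only the upper bound is
  recorded; the lower bound enters later through the number of edges.\<close>

locale rainbow_free =
  fixes V :: "'a set" and E :: "'a set set" and col :: "'a set \<Rightarrow> nat" and k :: nat
  assumes graph: "simple_graph V E"
    and rainbow_free: "\<not> rainbow_triangle E col x y z"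
    and class_le: "card (color_class E col i) \<le> k"
begin

section \<open>Degrees, apexes and triangle counts\<close>

definition nbr :: "'a \<Rightarrow> 'a set" where
  "nbr u = {v \<in> V. {u, v} \<in> E}"

definition deg :: "'a \<Rightarrow> real" where
  "deg u = real (card (nbr u))"

text \<open>A function of the vertex set, not of an ordered triple, so that every triangle gets a
  single apex; the choice breaks the tie in monochromatic triangles.\<close>

definition apex_of :: "'a set \<Rightarrow> 'a" where
  "apex_of S = (SOME t. t \<in> S \<and> (\<forall>x\<in>S - {t}. \<forall>y\<in>S - {t}. col {t, x} = col {t, y}))"

definition apex :: "'a \<Rightarrow> 'a \<Rightarrow> 'a \<Rightarrow> bool" where
  "apex z u v \<longleftrightarrow> {z, u} \<in> E \<and> {z, v} \<in> E \<and> {u, v} \<in> E \<and> apex_of {z, u, v} = z"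

text \<open>\<open>far\<close> and \<open>near\<close> are the \<open>f\<close> and \<open>g\<close>
  of the overview, and \<open>common_non\<close> is its \<open>w\<close>, before division by
  \<open>n\<close>.\<close>

definition far :: "'a \<Rightarrow> 'a \<Rightarrow> real" where
  "far u v = real (card {z \<in> V. apex z u v})"

definition near :: "'a \<Rightarrow> 'a \<Rightarrow> real" where
  "near u v = real (card {x \<in> V. apex u v x})"

definition color_deg :: "'a \<Rightarrow> 'a \<Rightarrow> real" where
  "color_deg u v = real (card {x \<in> nbr u. col {u, x} = col {u, v}})"

definition common_non :: "'a \<Rightarrow> 'a \<Rightarrow> real" where
  "common_non u v = real (card {x \<in> V. {u, x} \<notin> E \<and> {v, x} \<notin> E})"

abbreviation n :: real where "n \<equiv> real (card V)"

lemma finite_V: "finite V"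
  using graph by (simp add: simple_graph_def)

lemma finite_E: "finite E"
proof -
  have "E \<subseteq> Pow V" using graph by (auto simp: simple_graph_def)
  then show ?thesis using finite_V by (meson finite_Pow_iff rev_finite_subset)
qed

lemma finite_nbr: "finite (nbr u)"
  using finite_V by (simp add: nbr_def)

lemma edgeD:
  assumes "{u, v} \<in> E"
  shows "u \<in> V" "v \<in> V" "u \<noteq> v"
  using assms graph by (auto simp: simple_graph_def card_2_iff)

lemma nbr_sym: "v \<in> nbr u \<Longrightarrow> u \<in> nbr v"
  using edgeD by (auto simp: nbr_def insert_commute)

lemma apex_of_triangle:
  assumes "{x, y} \<in> E" "{x, z} \<in> E" "{y, z} \<in> E"
  defines "t \<equiv> apex_of {x, y, z}"
  shows "t \<in> {x, y, z} \<and> (\<forall>a\<in>{x, y, z} - {t}. \<forall>b\<in>{x, y, z} - {t}. col {t, a} = col {t, b})"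
proof -
  have d: "x \<noteq> y" "y \<noteq> z" "x \<noteq> z" using assms edgeD by blast+
  have "\<exists>t. t \<in> {x, y, z} \<and> (\<forall>a\<in>{x, y, z} - {t}. \<forall>b\<in>{x, y, z} - {t}. col {t, a} = col {t, b})"
  proof -
    have "\<not> distinct [col {x, y}, col {y, z}, col {x, z}]"
      using rainbow_free[of x y z] assms d by (auto simp: rainbow_triangle_def)
    then consider "col {x, y} = col {y, z}" | "col {x, y} = col {x, z}" | "col {y, z} = col {x, z}"
      by auto
    then show ?thesis
    proof cases
      case 1 then show ?thesis by (intro exI[of _ y]) (auto simp: insert_commute)
    next
      case 2 then show ?thesis by (intro exI[of _ x]) auto
    next
      case 3 then show ?thesis by (intro exI[of _ z]) (auto simp: insert_commute)
    qed
  qed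
  then show ?thesis unfolding t_def apex_of_def by (rule someI_ex)
qed

lemma apex_sym: "apex z u v \<longleftrightarrow> apex z v u"
  unfolding apex_def insert_commute[of u v "{}"] by blast

lemma apex_same_color:
  assumes "apex z u v"
  shows "col {z, u} = col {z, v}"
proof -
  have "{z, u} \<in> E" "{z, v} \<in> E" "{u, v} \<in> E" and z: "apex_of {z, u, v} = z"
    using assms by (auto simp: apex_def)
  moreover from this have "u \<noteq> z" "v \<noteq> z" using edgeD(3)[of z u] edgeD(3)[of z v] by auto
  ultimately show ?thesis using apex_of_triangle[of z u v] unfolding z by blast
qed

lemma apexD:
  assumes "apex z u v"
  shows "z \<in> V" "u \<in> nbr z" "v \<in> nbr z" "v \<in> nbr u" "u \<in> nbr v" "u \<in> V" "v \<in> V"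
proof -
  have e: "{z, u} \<in> E" "{z, v} \<in> E" "{u, v} \<in> E" "{v, u} \<in> E"
    using assms insert_commute[of u v "{}"] by (simp_all add: apex_def)
  show "z \<in> V" "u \<in> V" "v \<in> V" using edgeD[OF e(1)] edgeD[OF e(2)] by auto
  then show "u \<in> nbr z" "v \<in> nbr z" "v \<in> nbr u" "u \<in> nbr v" using e by (auto simp: nbr_def)
qed

lemma sum_deg: "(\<Sum>u\<in>V. deg u) = 2 * real (card E)"
proof -
  have "card (nbr u) = card {e \<in> E. u \<in> e}" for u
  proof (rule bij_betw_same_card)
    show "bij_betw (\<lambda>v. {u, v}) (nbr u) {e \<in> E. u \<in> e}"
    proof (rule bij_betw_imageI)
      show "inj_on (\<lambda>v. {u, v}) (nbr u)"
        by (auto simp: inj_on_def doubleton_eq_iff)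
      have "e \<in> (\<lambda>v. {u, v}) ` nbr u" if "e \<in> E" "u \<in> e" for e
      proof -
        have "card e = 2" "e \<subseteq> V" using that graph by (auto simp: simple_graph_def)
        then obtain a b where "e = {a, b}" "a \<in> V" "b \<in> V" by (auto simp: card_2_iff)
        then show ?thesis using that by (auto simp: nbr_def insert_commute)
      qed
      then show "(\<lambda>v. {u, v}) ` nbr u = {e \<in> E. u \<in> e}" by (auto simp: nbr_def)
    qed
  qed
  then have "(\<Sum>u\<in>V. card (nbr u)) = (\<Sum>u\<in>V. \<Sum>e\<in>{e \<in> E. u \<in> e}. 1)" by simp
  also have "\<dots> = (\<Sum>e\<in>E. \<Sum>u\<in>{u \<in> V. u \<in> e}. 1)"
    by (rule sum.swap_restrict[OF finite_V finite_E])
  also have "\<dots> = (\<Sum>e\<in>E. 2)"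
  proof (rule sum.cong[OF refl])
    fix e assume "e \<in> E"
    then have "card e = 2" "{u \<in> V. u \<in> e} = e" using graph by (auto simp: simple_graph_def)
    then show "(\<Sum>u\<in>{u \<in> V. u \<in> e}. 1) = (2::nat)" by simp
  qed
  finally show ?thesis by (simp add: deg_def flip: of_nat_sum)
qed

lemma deg_le: "deg u \<le> n"
  unfolding deg_def using finite_V by (auto intro!: card_mono simp: nbr_def)

lemma common_non_le: "common_non u v \<le> n - deg u"
proof -
  have "card {x \<in> V. {u, x} \<notin> E \<and> {v, x} \<notin> E} + card (nbr u) =
      card ({x \<in> V. {u, x} \<notin> E \<and> {v, x} \<notin> E} \<union> nbr u)"
    using finite_V by (subst card_Un_disjoint) (auto simp: nbr_def)
  also have "\<dots> \<le> card V" using finite_V by (intro card_mono) (auto simp: nbr_def)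
  finally show ?thesis unfolding common_non_def deg_def by linarith
qed

lemma common_non_sym: "common_non u v = common_non v u"
  unfolding common_non_def by (simp add: conj_commute)

lemma far_sym: "far u v = far v u"
  unfolding far_def using apex_sym by simp

text \<open>Each common neighbor closes a triangle on \<open>uv\<close> with exactly one apex:
  itself, \<open>u\<close> or \<open>v\<close>. The rest is inclusion and exclusion for the two
  neighborhoods, whose union misses exactly the common non-neighbors.\<close>

lemma codegree_split:
  assumes e: "{u, v} \<in> E"
  shows "far u v + near u v + near v u + n = deg u + deg v + common_non u v"
proof -
  define A where "A = {z \<in> V. apex z u v}"
  define B where "B = {x \<in> V. apex u v x}"
  define C where "C = {x \<in> V. apex v u x}"
  have uv: "u \<noteq> v" using edgeD[OF e] by simp
  have apex_iff: "apex x u v \<longleftrightarrow> {u, x} \<in> E \<and> {v, x} \<in> E \<and> apex_of {u, v, x} = x"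
      "apex u v x \<longleftrightarrow> {u, x} \<in> E \<and> {v, x} \<in> E \<and> apex_of {u, v, x} = u"
      "apex v u x \<longleftrightarrow> {u, x} \<in> E \<and> {v, x} \<in> E \<and> apex_of {u, v, x} = v" for x
  proof -
    have "{v, u} = {u, v}" "{x, u} = {u, x}" "{x, v} = {v, x}" "{x, u, v} = {u, v, x}"
      "{v, u, x} = {u, v, x}" by blast+
    then show "apex x u v \<longleftrightarrow> {u, x} \<in> E \<and> {v, x} \<in> E \<and> apex_of {u, v, x} = x"
      "apex u v x \<longleftrightarrow> {u, x} \<in> E \<and> {v, x} \<in> E \<and> apex_of {u, v, x} = u"
      "apex v u x \<longleftrightarrow> {u, x} \<in> E \<and> {v, x} \<in> E \<and> apex_of {u, v, x} = v"
      using e by (auto simp: apex_def)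
  qed
  have "A \<union> B \<union> C = nbr u \<inter> nbr v"
  proof
    show "A \<union> B \<union> C \<subseteq> nbr u \<inter> nbr v"
      unfolding A_def B_def C_def nbr_def apex_iff by blast
    show "nbr u \<inter> nbr v \<subseteq> A \<union> B \<union> C"
    proof
      fix z assume "z \<in> nbr u \<inter> nbr v"
      then have z: "{u, z} \<in> E" "{v, z} \<in> E" "z \<in> V" by (auto simp: nbr_def)
      then have "apex_of {u, v, z} \<in> {u, v, z}" using apex_of_triangle[of u v z] e by blast
      then show "z \<in> A \<union> B \<union> C" using z unfolding A_def B_def C_def apex_iff by blast
    qed
  qed
  moreover have "A \<inter> B = {}" "(A \<union> B) \<inter> C = {}"
  proof -
    have "{u} \<notin> E" "{v} \<notin> E" using edgeD(3)[of u u] edgeD(3)[of v v] by auto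
    then show "A \<inter> B = {}" "(A \<union> B) \<inter> C = {}"
      using uv unfolding A_def B_def C_def apex_iff by auto
  qed
  moreover have "finite A" "finite B" "finite C"
    using finite_V by (auto simp: A_def B_def C_def)
  ultimately have 1: "card A + card B + card C = card (nbr u \<inter> nbr v)"
    by (simp add: card_Un_disjoint[symmetric])
  have 2: "card (nbr u) + card (nbr v) = card (nbr u \<union> nbr v) + card (nbr u \<inter> nbr v)"
    by (rule card_Un_Int[OF finite_nbr finite_nbr])
  have "card (nbr u \<union> nbr v) + card {x \<in> V. {u, x} \<notin> E \<and> {v, x} \<notin> E} =
      card ((nbr u \<union> nbr v) \<union> {x \<in> V. {u, x} \<notin> E \<and> {v, x} \<notin> E})"
    using finite_V finite_nbr by (subst card_Un_disjoint) (auto simp: nbr_def)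
  also have "(nbr u \<union> nbr v) \<union> {x \<in> V. {u, x} \<notin> E \<and> {v, x} \<notin> E} = V"
    by (auto simp: nbr_def)
  finally show ?thesis
    using 1 2 unfolding far_def near_def deg_def common_non_def A_def B_def C_def by linarith
qed

text \<open>The \<open>1\<close> is \<open>v\<close> itself: it has the right color but is not the
  third vertex of a triangle on \<open>uv\<close>.\<close>

lemma near_lt_color_deg:
  assumes e: "{u, v} \<in> E"
  shows "near u v + 1 \<le> color_deg u v"
proof -
  have "{x \<in> V. apex u v x} \<subset> {x \<in> nbr u. col {u, x} = col {u, v}}"
  proof
    show "{x \<in> V. apex u v x} \<subseteq> {x \<in> nbr u. col {u, x} = col {u, v}}"
      using apex_same_color apexD by fastforce
    have "v \<in> {x \<in> nbr u. col {u, x} = col {u, v}}" using e edgeD[OF e] by (simp add: nbr_def)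
    moreover have "\<not> apex u v v" using edgeD(3)[of v v] by (auto simp: apex_def)
    ultimately show "{x \<in> V. apex u v x} \<noteq> {x \<in> nbr u. col {u, x} = col {u, v}}" by blast
  qed
  then have "card {x \<in> V. apex u v x} < card {x \<in> nbr u. col {u, x} = col {u, v}}"
    by (rule psubset_card_mono[rotated]) (simp add: finite_nbr)
  then show ?thesis unfolding near_def color_deg_def by linarith
qed

text \<open>The stars at \<open>u\<close> and \<open>v\<close> in the color of \<open>uv\<close> lie
  in one color class and share only the edge \<open>uv\<close>, hence the \<open>1\<close>.\<close>

lemma color_deg_add_le:
  assumes e: "{u, v} \<in> E"
  shows "color_deg u v + color_deg v u \<le> real k + 1"
proof -
  define A where "A = (\<lambda>x. {u, x}) ` {x \<in> nbr u. col {u, x} = col {u, v}}"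
  define B where "B = (\<lambda>x. {v, x}) ` {x \<in> nbr v. col {v, x} = col {v, u}}"
  have vu: "{v, u} = {u, v}" by blast
  have cA: "card A = card {x \<in> nbr u. col {u, x} = col {u, v}}"
    unfolding A_def by (intro card_image) (auto simp: inj_on_def doubleton_eq_iff)
  have cB: "card B = card {x \<in> nbr v. col {v, x} = col {v, u}}"
    unfolding B_def by (intro card_image) (auto simp: inj_on_def doubleton_eq_iff)
  have "A \<inter> B \<subseteq> {{u, v}}"
    using edgeD[OF e] by (auto simp: A_def B_def doubleton_eq_iff)
  then have "card (A \<inter> B) \<le> 1" using card_mono[of "{{u, v}}" "A \<inter> B"] by simp
  moreover have "A \<union> B \<subseteq> color_class E col (col {u, v})"
    unfolding A_def B_def color_class_def nbr_def vu by blast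
  then have "card (A \<union> B) \<le> k"
    using class_le[of "col {u, v}"] finite_E card_mono[of "color_class E col (col {u, v})" "A \<union> B"]
    by (simp add: color_class_def)
  moreover have "card A + card B = card (A \<union> B) + card (A \<inter> B)"
    by (rule card_Un_Int) (auto simp: A_def B_def finite_nbr)
  ultimately show ?thesis unfolding color_deg_def using cA cB by linarith
qed

text \<open>Both sides count the pairs \<open>(v, z)\<close> with \<open>apex z u v\<close>: on the
  left by the edge \<open>uv\<close> opposite the apex, on the right by the edge from the apex to
  \<open>u\<close>.\<close>

lemma sum_far_eq_sum_near:
  "(\<Sum>v\<in>nbr u. far u v) = (\<Sum>v\<in>nbr u. near v u)"
proof -
  have "(\<Sum>v\<in>nbr u. far u v) = (\<Sum>v\<in>V. \<Sum>z\<in>V. of_bool (apex z u v))"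
  proof (rule sum.mono_neutral_cong_left)
    show "\<forall>v\<in>V - nbr u. (\<Sum>z\<in>V. of_bool (apex z u v)) = (0::real)"
      using apexD(4) by (auto intro!: sum.neutral)
  qed (auto simp: finite_V nbr_def far_def Int_def)
  also have "\<dots> = (\<Sum>z\<in>V. \<Sum>v\<in>V. of_bool (apex z u v))" by (rule sum.swap)
  also have "\<dots> = (\<Sum>v\<in>nbr u. near v u)"
  proof (rule sum.mono_neutral_cong_right)
    show "\<forall>z\<in>V - nbr u. (\<Sum>v\<in>V. of_bool (apex z u v)) = (0::real)"
      using apexD(2) nbr_sym by (auto intro!: sum.neutral)
  qed (auto simp: finite_V nbr_def near_def Int_def)
  finally show ?thesis .
qed

text \<open>The same-color relation on the neighbors of \<open>z\<close> is positive semidefinite.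
  By \<open>2 * (y u * y v) \<le> (y u)\<^sup>2 + (y v)\<^sup>2\<close>, passing to the smaller apex
  relation costs a diagonal term whose weight at \<open>u\<close> is the number of pairs lost
  there.\<close>

lemma star_inequality_vertex:
  fixes y :: "'a \<Rightarrow> real"
  shows "0 \<le> (\<Sum>u\<in>V. \<Sum>v\<in>V. of_bool (apex z u v) * (y u * y v))
      + (\<Sum>u\<in>nbr z. (color_deg z u - near z u) * (y u)\<^sup>2)"
proof -
  define s where "s u v = (of_bool (col {z, u} = col {z, v}) :: real)" for u v
  define a where "a u v = (of_bool (apex z u v) :: real)" for u v
  have sym: "s u v = s v u" "a u v = a v u" for u v
    using apex_sym by (auto simp: s_def a_def)
  have as: "a u v \<le> s u v" for u v
    using apex_same_color by (auto simp: s_def a_def)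
  have restrict: "(\<Sum>u\<in>V. \<Sum>v\<in>V. a u v * (y u * y v)) = (\<Sum>u\<in>nbr z. \<Sum>v\<in>nbr z. a u v * (y u * y v))"
  proof (rule sum.mono_neutral_cong_right)
    show "\<forall>u\<in>V - nbr z. (\<Sum>v\<in>V. a u v * (y u * y v)) = 0"
      using apexD(2) by (auto intro!: sum.neutral simp: a_def)
    show "(\<Sum>v\<in>V. a u v * (y u * y v)) = (\<Sum>v\<in>nbr z. a u v * (y u * y v))" for u
      by (rule sum.mono_neutral_right)
        (use finite_V apexD(3) in \<open>auto simp: nbr_def a_def\<close>)
  qed (auto simp: finite_V nbr_def)
  have "0 \<le> (\<Sum>u\<in>nbr z. \<Sum>v\<in>nbr z. s u v * (y u * y v))"
    unfolding s_def by (rule sum_same_value_products_nonneg[OF finite_nbr])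
  also have "\<dots> \<le> (\<Sum>u\<in>nbr z. \<Sum>v\<in>nbr z. a u v * (y u * y v) + (s u v - a u v) * ((y u)\<^sup>2 + (y v)\<^sup>2) / 2)"
  proof (intro sum_mono)
    fix u v
    have "(s u v - a u v) * (2 * (y u * y v)) \<le> (s u v - a u v) * ((y u)\<^sup>2 + (y v)\<^sup>2)"
      using as[of u v] sum_squares_bound[of "y u" "y v"] by (intro mult_left_mono) auto
    then show "s u v * (y u * y v) \<le>
        a u v * (y u * y v) + (s u v - a u v) * ((y u)\<^sup>2 + (y v)\<^sup>2) / 2"
      by (simp add: field_simps)
  qed
  also have "\<dots> = (\<Sum>u\<in>nbr z. \<Sum>v\<in>nbr z. a u v * (y u * y v))
      + (\<Sum>u\<in>nbr z. \<Sum>v\<in>nbr z. (s u v - a u v) * (y u)\<^sup>2)"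
  proof -
    have "(\<Sum>u\<in>nbr z. \<Sum>v\<in>nbr z. (s u v - a u v) * (y v)\<^sup>2) =
        (\<Sum>u\<in>nbr z. \<Sum>v\<in>nbr z. (s u v - a u v) * (y u)\<^sup>2)"
      by (subst sum.swap) (simp add: sym)
    then show ?thesis
      by (simp add: sum.distrib distrib_left add_divide_distrib flip: sum_divide_distrib)
  qed
  also have "(\<Sum>u\<in>nbr z. \<Sum>v\<in>nbr z. (s u v - a u v) * (y u)\<^sup>2) =
      (\<Sum>u\<in>nbr z. (color_deg z u - near z u) * (y u)\<^sup>2)"
  proof (rule sum.cong[OF refl])
    fix u
    have "(\<Sum>v\<in>nbr z. s u v) = color_deg z u"
      unfolding s_def color_deg_def by (simp add: finite_nbr Int_def eq_commute)
    moreover have "(\<Sum>v\<in>nbr z. a u v) = near z u"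
    proof -
      have "nbr z \<inter> {v. apex z u v} = {v \<in> V. apex z u v}" by (auto dest: apexD)
      then show ?thesis unfolding a_def near_def by (simp add: finite_nbr)
    qed
    ultimately show "(\<Sum>v\<in>nbr z. (s u v - a u v) * (y u)\<^sup>2) = (color_deg z u - near z u) * (y u)\<^sup>2"
      by (simp add: sum_subtractf flip: sum_distrib_right)
  qed
  finally show ?thesis using restrict by (simp add: a_def)
qed

text \<open>In the previous inequality \<open>y\<close> is taken as the weighted centered
  non-adjacency to \<open>t\<close>. Summed over \<open>t\<close>, products become covariances and
  squares become variances.\<close>

lemma star_inequality:
  fixes \<eta> :: "'a \<Rightarrow> real"
  assumes "V \<noteq> {}"
  defines "x \<equiv> (\<lambda>u. 1 - deg u / n)"
  shows "0 \<le> (\<Sum>u\<in>V. \<Sum>v\<in>nbr u. far u v * (\<eta> u * \<eta> v * (common_non u v - n * x u * x v)))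
      + (\<Sum>z\<in>V. \<Sum>u\<in>nbr z. (color_deg z u - near z u) * (n * (\<eta> u)\<^sup>2 * x u * (1 - x u)))"
proof -
  have n: "0 < n" using assms finite_V by (simp add: card_gt_0_iff)
  define y where "y t u = \<eta> u * (of_bool ({u, t} \<notin> E) - x u)" for t u
  have non: "(\<Sum>t\<in>V. of_bool ({u, t} \<notin> E)) = n * x u" for u
  proof -
    have "card {t \<in> V. {u, t} \<notin> E} + card (nbr u) = card ({t \<in> V. {u, t} \<notin> E} \<union> nbr u)"
      using finite_V by (subst card_Un_disjoint) (auto simp: nbr_def)
    also have "{t \<in> V. {u, t} \<notin> E} \<union> nbr u = V" by (auto simp: nbr_def)
    finally show ?thesis
      using n finite_V unfolding x_def deg_def by (simp add: Int_def field_simps)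
  qed
  \<comment> \<open>Kept as a product of indicators, so that the case \<open>u = v\<close> yields
    the variance.\<close>
  have cov: "(\<Sum>t\<in>V. y t u * y t v) =
      \<eta> u * \<eta> v * ((\<Sum>t\<in>V. of_bool ({u, t} \<notin> E) * of_bool ({v, t} \<notin> E)) - n * x u * x v)" for u v
  proof -
    have "(\<Sum>t\<in>V. y t u * y t v) = \<eta> u * \<eta> v * (\<Sum>t\<in>V. of_bool ({u, t} \<notin> E) * of_bool ({v, t} \<notin> E)
        - x v * of_bool ({u, t} \<notin> E) - x u * of_bool ({v, t} \<notin> E) + x u * x v)"
      unfolding y_def sum_distrib_left by (intro sum.cong refl) (simp add: algebra_simps)
    also have "\<dots> = \<eta> u * \<eta> v * ((\<Sum>t\<in>V. of_bool ({u, t} \<notin> E) * of_bool ({v, t} \<notin> E))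
        - x v * (n * x u) - x u * (n * x v) + n * (x u * x v))"
      by (simp add: sum.distrib sum_subtractf non flip: sum_distrib_left)
    finally show ?thesis by (simp add: algebra_simps)
  qed
  have cov_uv: "(\<Sum>t\<in>V. y t u * y t v) = \<eta> u * \<eta> v * (common_non u v - n * x u * x v)" for u v
    unfolding cov common_non_def using finite_V by (simp add: Int_def flip: of_bool_conj)
  have cov_uu: "(\<Sum>t\<in>V. (y t u)\<^sup>2) = n * (\<eta> u)\<^sup>2 * x u * (1 - x u)" for u
  proof -
    have "(\<Sum>t\<in>V. (y t u)\<^sup>2) = \<eta> u * \<eta> u * (n * x u - n * x u * x u)"
      unfolding power2_eq_square cov by (simp add: non flip: of_bool_conj)
    then show ?thesis by (simp add: algebra_simps power2_eq_square)
  qed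
  have "0 \<le> (\<Sum>t\<in>V. \<Sum>z\<in>V. (\<Sum>u\<in>V. \<Sum>v\<in>V. of_bool (apex z u v) * (y t u * y t v))
      + (\<Sum>u\<in>nbr z. (color_deg z u - near z u) * (y t u)\<^sup>2))"
    by (intro sum_nonneg star_inequality_vertex)
  also have "\<dots> = (\<Sum>t\<in>V. \<Sum>z\<in>V. \<Sum>u\<in>V. \<Sum>v\<in>V. of_bool (apex z u v) * (y t u * y t v))
      + (\<Sum>t\<in>V. \<Sum>z\<in>V. \<Sum>u\<in>nbr z. (color_deg z u - near z u) * (y t u)\<^sup>2)"
    by (simp add: sum.distrib)
  finally have nonneg: "0 \<le> (\<Sum>t\<in>V. \<Sum>z\<in>V. \<Sum>u\<in>V. \<Sum>v\<in>V. of_bool (apex z u v) * (y t u * y t v))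
      + (\<Sum>t\<in>V. \<Sum>z\<in>V. \<Sum>u\<in>nbr z. (color_deg z u - near z u) * (y t u)\<^sup>2)" .
  have loss: "(\<Sum>t\<in>V. \<Sum>z\<in>V. \<Sum>u\<in>nbr z. (color_deg z u - near z u) * (y t u)\<^sup>2) =
      (\<Sum>z\<in>V. \<Sum>u\<in>nbr z. (color_deg z u - near z u) * (n * (\<eta> u)\<^sup>2 * x u * (1 - x u)))"
    unfolding cov_uu[symmetric] sum_distrib_left
    by (subst sum.swap, rule sum.cong[OF refl], rule sum.swap)
  have "(\<Sum>t\<in>V. \<Sum>z\<in>V. \<Sum>u\<in>V. \<Sum>v\<in>V. of_bool (apex z u v) * (y t u * y t v)) =
      (\<Sum>z\<in>V. \<Sum>t\<in>V. \<Sum>u\<in>V. \<Sum>v\<in>V. of_bool (apex z u v) * (y t u * y t v))"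
    by (rule sum.swap)
  also have "\<dots> = (\<Sum>z\<in>V. \<Sum>u\<in>V. \<Sum>t\<in>V. \<Sum>v\<in>V. of_bool (apex z u v) * (y t u * y t v))"
    by (rule sum.cong[OF refl], rule sum.swap)
  also have "\<dots> = (\<Sum>z\<in>V. \<Sum>u\<in>V. \<Sum>v\<in>V. \<Sum>t\<in>V. of_bool (apex z u v) * (y t u * y t v))"
    by (rule sum.cong[OF refl], rule sum.cong[OF refl], rule sum.swap)
  also have "\<dots> = (\<Sum>u\<in>V. \<Sum>z\<in>V. \<Sum>v\<in>V. \<Sum>t\<in>V. of_bool (apex z u v) * (y t u * y t v))"
    by (rule sum.swap)
  also have "\<dots> = (\<Sum>u\<in>V. \<Sum>v\<in>V. \<Sum>z\<in>V. \<Sum>t\<in>V. of_bool (apex z u v) * (y t u * y t v))"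
    by (rule sum.cong[OF refl], rule sum.swap)
  also have "\<dots> = (\<Sum>u\<in>V. \<Sum>v\<in>V. far u v * (\<eta> u * \<eta> v * (common_non u v - n * x u * x v)))"
  proof (intro sum.cong refl)
    fix u v
    have "far u v = (\<Sum>z\<in>V. of_bool (apex z u v))"
      unfolding far_def using finite_V by (simp add: Int_def)
    then show "(\<Sum>z\<in>V. \<Sum>t\<in>V. of_bool (apex z u v) * (y t u * y t v)) =
        far u v * (\<eta> u * \<eta> v * (common_non u v - n * x u * x v))"
      unfolding cov_uv[symmetric] by (simp only: sum_product)
  qed
  also have "\<dots> = (\<Sum>u\<in>V. \<Sum>v\<in>nbr u. far u v * (\<eta> u * \<eta> v * (common_non u v - n * x u * x v)))"
  proof (rule sum.cong[OF refl], rule sum.mono_neutral_right)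
    fix u
    have "far u v = 0" if "v \<in> V - nbr u" for v
      using that apexD(4) unfolding far_def by (auto simp: card_eq_0_iff)
    then show "\<forall>v\<in>V - nbr u. far u v * (\<eta> u * \<eta> v * (common_non u v - n * x u * x v)) = 0" by simp
  qed (auto simp: finite_V nbr_def)
  finally show ?thesis using nonneg unfolding loss by simp
qed

end

section \<open>Rainbow triangles\<close>

text \<open>The factor \<open>1/2\<close> is what lets the losses at both ends of an edge add up to
  \<open>max x y * (\<beta> - g - g')\<close>, up to rounding.\<close>

lemma star_variance_le:
  fixes x :: real
  assumes "0 \<le> x"
  shows "(1/2 + x)\<^sup>2 * x * (1 - x) \<le> x / 2"
proof -
  have "x / 2 - (1/2 + x)\<^sup>2 * x * (1 - x) = x * ((x - 1/2)\<^sup>2 * (x + 1))"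
    by (simp add: power2_eq_square field_simps)
  moreover have "0 \<le> x * ((x - 1/2)\<^sup>2 * (x + 1))" using assms by simp
  ultimately show ?thesis by linarith
qed

text \<open>\<open>val u v\<close> is the contribution of an ordered edge. The total is bounded
  above through the number of edges, but the two orientations of an edge together contribute more
  than \<open>- \<rho>\<close>; these bounds clash.\<close>

lemma (in rainbow_free) no_dense_coloring:
  fixes \<beta> \<delta> \<mu> \<nu> c :: real
  assumes gw: "good_weights \<beta> \<delta> \<mu> \<nu> c" and pos: "0 < c" "0 < \<delta>" "\<beta> \<le> 2 * c * \<delta>"
    and V: "V \<noteq> {}" and k: "real k - 1 < \<beta> * n" "\<beta> * n \<le> real k"
    and E: "\<delta> * n * real k \<le> 2 * \<beta> * real (card E)"
  shows False
proof -
  interpret good_weights \<beta> \<delta> \<mu> \<nu> c by fact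
  define x where "x u = 1 - deg u / n" for u
  define \<eta> where "\<eta> u = 1/2 + x u" for u
  define Y where "Y u = (\<eta> u)\<^sup>2 * x u * (1 - x u)" for u
  \<comment> \<open>The rounding error, in units of \<open>n\<close>, from replacing
    \<open>\<beta> * n\<close> by the integer \<open>k\<close>.\<close>
  define \<rho> where "\<rho> = real k / n - \<beta>"
  define e where "e = real (card E)"
  define val where "val u v = (\<mu> - \<nu> * x u) / n * (far u v - near v u)
      - far u v * (\<eta> u * \<eta> v * (common_non u v - n * x u * x v)) / n\<^sup>2
      - (color_deg u v - near u v) * (n * (\<eta> v)\<^sup>2 * x v * (1 - x v)) / n\<^sup>2
      + c * (\<delta> / (1 - x u) - 1)" for u v
  have n: "0 < n" using V finite_V by (simp add: card_gt_0_iff)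
  have k0: "0 < real k" using k beta n by (smt (verit) mult_pos_pos)
  have rho: "0 \<le> \<rho>" using k n by (simp add: \<rho>_def field_simps)
  have "0 < \<delta> * n * real k" using pos n k0 by simp
  then have "0 < 2 * \<beta> * real (card E)" using E by linarith
  then have e0: "0 < e" using beta by (simp add: e_def zero_less_mult_iff)
  have edges: "(\<Sum>u\<in>V. deg u) = 2 * e" unfolding e_def by (rule sum_deg)

  have rescale: "m / n * (a - b) = m * (a / n - b / n)"
      "a * (b * (d - n * p * q)) / n\<^sup>2 = a / n * b * (d / n - p * q)"
      "a * (n * b * p * q) / n\<^sup>2 = a * (b * p * q) / n" for m a b d p q
    using n by (simp_all add: power2_eq_square field_simps)

  have edge_pos: "0 < val u v + val v u + \<rho>" if uv: "{u, v} \<in> E" for u v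
  proof -
    have vu: "{v, u} \<in> E" using uv by (simp add: insert_commute)
    have "v \<in> nbr u" "u \<in> nbr v" using uv vu edgeD[OF uv] by (auto simp: nbr_def)
    then have deg: "0 < deg u" "0 < deg v"
      unfolding deg_def using finite_nbr by (auto simp: card_gt_0_iff)
    have x: "0 \<le> x u" "x u < 1" "0 \<le> x v" "x v < 1"
      using deg deg_le n by (auto simp: x_def)
    define w g g' f where "w = common_non u v / n" and "g = near u v / n"
      and "g' = near v u / n" and "f = far u v / n"
    have w: "0 \<le> w" "w \<le> x u" "w \<le> x v"
      using common_non_le[of u v] common_non_le[of v u] common_non_sym[of u v] n
      by (auto simp: w_def x_def common_non_def field_simps)
    have g: "0 \<le> g" "0 \<le> g'" and f: "0 \<le> f"
      using n by (auto simp: g_def g'_def f_def near_def far_def)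
    have slack: "near u v + 1 \<le> color_deg u v" "near v u + 1 \<le> color_deg v u"
        "color_deg u v + color_deg v u \<le> real k + 1"
      using near_lt_color_deg[OF uv] near_lt_color_deg[OF vu] color_deg_add_le[OF uv] by auto
    \<comment> \<open>The two counts add up to at most \<open>k - 1\<close>, which is below
      \<open>\<beta> * n\<close>: here rounding up costs nothing.\<close>
    then have "(near u v + near v u) / n \<le> (\<beta> * n) / n"
      using k n by (intro divide_right_mono) linarith+
    then have gg: "g + g' \<le> \<beta>" using n by (simp add: g_def g'_def add_divide_distrib)
    have f_eq: "f = 1 - x u - x v + w - g - g'"
    proof -
      have "far u v = deg u + deg v + common_non u v - n - near u v - near v u"
        using codegree_split[OF uv] by linarith
      then show ?thesis
        using n unfolding f_def w_def g_def g'_def x_def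
        by (simp add: diff_divide_distrib add_divide_distrib)
    qed
    have ineq: "0 < (\<mu> - \<nu> * x u) * (f - g') + (\<mu> - \<nu> * x v) * (f - g)
        - 2 * f * ((1/2 + x u) * (1/2 + x v)) * (w - x u * x v) - max (x u) (x v) * (\<beta> - g - g')
        + c * (\<delta> / (1 - x u) + \<delta> / (1 - x v) - 2)"
      by (rule edge_ineq) (use x w g gg f f_eq in auto)
    have loss: "(color_deg u v - near u v) * Y v / n + (color_deg v u - near v u) * Y u / n \<le>
        max (x u) (x v) * (\<beta> - g - g') + \<rho>"
    proof -
      define m where "m = max (x u) (x v)"
      have m: "0 \<le> m" "m \<le> 1" using x by (auto simp: m_def)
      have Y: "Y v \<le> m / 2" "Y u \<le> m / 2"
        using star_variance_le[of "x u"] star_variance_le[of "x v"] x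
        unfolding Y_def \<eta>_def m_def by auto
      have "(color_deg u v - near u v) * Y v + (color_deg v u - near v u) * Y u \<le>
          (color_deg u v - near u v) * (m / 2) + (color_deg v u - near v u) * (m / 2)"
        using slack Y by (intro add_mono mult_left_mono) auto
      also have "\<dots> = (color_deg u v + color_deg v u - near u v - near v u) / 2 * m"
        by (simp add: field_simps)
      \<comment> \<open>The color degrees add up to at most \<open>k + 1\<close> and the
        \<open>near\<close> counts to at most \<open>k - 1\<close>; the two deviations cancel in the
        total \<open>2 * k\<close>.\<close>
      also have "\<dots> \<le> (real k - near u v - near v u) * m"
        using slack m by (intro mult_right_mono) auto
      finally have "((color_deg u v - near u v) * Y v + (color_deg v u - near v u) * Y u) / n \<le>
          (real k - near u v - near v u) * m / n"
        using n by (intro divide_right_mono) auto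
      also have "\<dots> = m * (\<beta> - g - g') + m * \<rho>"
        using n by (simp add: \<rho>_def g_def g'_def field_simps)
      also have "\<dots> \<le> m * (\<beta> - g - g') + \<rho>"
        using m rho by (simp add: mult_left_le_one_le)
      finally show ?thesis by (simp add: m_def add_divide_distrib)
    qed
    have "val u v = (\<mu> - \<nu> * x u) * (f - g') - f * ((1/2 + x u) * (1/2 + x v)) * (w - x u * x v)
        - (color_deg u v - near u v) * Y v / n + c * (\<delta> / (1 - x u) - 1)"
      unfolding val_def rescale f_def g'_def w_def Y_def \<eta>_def ..
    moreover have "val v u = (\<mu> - \<nu> * x v) * (f - g) - f * ((1/2 + x u) * (1/2 + x v)) * (w - x u * x v)
        - (color_deg v u - near v u) * Y u / n + c * (\<delta> / (1 - x v) - 1)"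
      unfolding val_def rescale f_def g_def w_def Y_def \<eta>_def far_sym[of v u] common_non_sym[of v u]
      by (simp only: mult.commute[of "x v"] mult.commute[of "1/2 + x v"])
    moreover have "c * (\<delta> / (1 - x u) + \<delta> / (1 - x v) - 2) =
        c * (\<delta> / (1 - x u) - 1) + c * (\<delta> / (1 - x v) - 1)"
      by (simp add: algebra_simps)
    ultimately show ?thesis using ineq loss by linarith
  qed

  have upper: "(\<Sum>u\<in>V. \<Sum>v\<in>nbr u. val u v) \<le> c * (\<delta> * n\<^sup>2 - 2 * e)"
  proof -
    \<comment> \<open>The multiplier depends on \<open>u\<close> alone, so the double counting
      cancels the sum at each \<open>u\<close>.\<close>
    have "(\<Sum>u\<in>V. \<Sum>v\<in>nbr u. (\<mu> - \<nu> * x u) / n * (far u v - near v u)) = 0"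
      by (rule sum.neutral)
        (simp only: sum_distrib_left[symmetric] sum_subtractf sum_far_eq_sum_near, simp)
    moreover have "0 \<le> (\<Sum>u\<in>V. \<Sum>v\<in>nbr u. far u v * (\<eta> u * \<eta> v * (common_non u v - n * x u * x v)) / n\<^sup>2)
        + (\<Sum>u\<in>V. \<Sum>v\<in>nbr u. (color_deg u v - near u v) * (n * (\<eta> v)\<^sup>2 * x v * (1 - x v)) / n\<^sup>2)"
      using divide_nonneg_nonneg[OF star_inequality[OF V, of \<eta>], of "n\<^sup>2"]
      by (simp only: x_def[symmetric] add_divide_distrib sum_divide_distrib) simp
    moreover have "(\<Sum>u\<in>V. \<Sum>v\<in>nbr u. c * (\<delta> / (1 - x u) - 1)) \<le> c * (\<delta> * n\<^sup>2 - 2 * e)"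
    proof -
      \<comment> \<open>Equality unless \<open>u\<close> is isolated; then the sum is empty and the
        right-hand side is positive.\<close>
      have "(\<Sum>v\<in>nbr u. c * (\<delta> / (1 - x u) - 1)) \<le> c * (\<delta> * n - deg u)" for u
      proof (cases "deg u = 0")
        case True
        then show ?thesis using finite_nbr[of u] pos n by (simp add: deg_def)
      next
        case False
        have "(\<Sum>v\<in>nbr u. c * (\<delta> / (1 - x u) - 1)) = deg u * (c * (\<delta> / (1 - x u) - 1))"
          by (simp add: deg_def)
        also have "\<dots> = c * (\<delta> * n - deg u)"
          using False n by (simp add: x_def field_simps)
        finally show ?thesis by (rule eq_refl)
      qed
      then have "(\<Sum>u\<in>V. \<Sum>v\<in>nbr u. c * (\<delta> / (1 - x u) - 1)) \<le> (\<Sum>u\<in>V. c * (\<delta> * n - deg u))"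
        by (intro sum_mono)
      also have "\<dots> = c * (\<delta> * n\<^sup>2 - 2 * e)"
        using edges by (simp add: sum_subtractf power2_eq_square flip: sum_distrib_left)
      finally show ?thesis .
    qed
    ultimately show ?thesis
      unfolding val_def by (simp add: sum.distrib sum_subtractf)
  qed

  have swap: "(\<Sum>u\<in>V. \<Sum>v\<in>nbr u. val v u) = (\<Sum>u\<in>V. \<Sum>v\<in>nbr u. val u v)"
    unfolding nbr_def by (subst sum.swap_restrict[OF finite_V finite_V]) (simp add: insert_commute)
  have "0 < (\<Sum>(u, v)\<in>Sigma V nbr. val u v + val v u + \<rho>)"
  proof (rule sum_pos)
    show "finite (Sigma V nbr)" using finite_V finite_nbr by auto
    show "Sigma V nbr \<noteq> {}"
    proof
      assume "Sigma V nbr = {}"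
      then have "nbr u = {}" if "u \<in> V" for u using that by blast
      then have "(\<Sum>u\<in>V. deg u) = 0" by (simp add: deg_def)
      then show False using edges e0 by simp
    qed
    show "0 < (case p of (u, v) \<Rightarrow> val u v + val v u + \<rho>)" if "p \<in> Sigma V nbr" for p
      using that edge_pos by (auto simp: nbr_def)
  qed
  also have "\<dots> = (\<Sum>u\<in>V. \<Sum>v\<in>nbr u. val u v + val v u + \<rho>)"
    using finite_V finite_nbr by (subst sum.Sigma) auto
  also have "\<dots> = 2 * (\<Sum>u\<in>V. \<Sum>v\<in>nbr u. val u v) + (\<Sum>u\<in>V. deg u * \<rho>)"
    using swap by (simp add: sum.distrib deg_def)
  also have "(\<Sum>u\<in>V. deg u * \<rho>) = 2 * e * \<rho>"
    using edges by (simp flip: sum_distrib_right)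
  finally have "2 * c * (2 * e - \<delta> * n\<^sup>2) < 2 * e * \<rho>"
    using upper by (simp add: algebra_simps)
  \<comment> \<open>With \<open>k = (\<beta> + \<rho>) * n\<close>, the edge bound makes
    \<open>2 * e * \<rho> * n\<close> at most \<open>(2 * e - \<delta> * n\<^sup>2) * k\<close>.
    Since \<open>2 * e \<le> n\<^sup>2\<close>, it also gives
    \<open>\<delta> * k \<le> \<beta> * n\<close>, and \<open>\<beta> \<le> 2 * c * \<delta>\<close>
    turns this into \<open>k \<le> 2 * c * n\<close>. So the extra edges of the rounded-up classes
    pay for the rounding error.\<close>
  moreover have "2 * e * \<rho> \<le> 2 * c * (2 * e - \<delta> * n\<^sup>2)"
  proof -
    have "2 * e \<le> (\<Sum>u\<in>V. n)" unfolding edges[symmetric] using deg_le by (intro sum_mono)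
    then have "2 * e \<le> n * n" by simp
    then have "\<beta> * (2 * e) \<le> \<beta> * (n * n)" using beta by (intro mult_left_mono) auto
    moreover have "\<delta> * n * real k \<le> \<beta> * (2 * e)" using E by (simp add: e_def mult_ac)
    ultimately have "\<delta> * n * real k \<le> \<beta> * (n * n)" by (rule order_trans[rotated])
    then have "\<delta> * real k * n \<le> \<beta> * n * n" by (simp add: mult_ac)
    then have "\<delta> * real k \<le> \<beta> * n" using n by simp
    also have "\<dots> \<le> 2 * c * \<delta> * n" using pos n by simp
    finally have kn: "real k \<le> 2 * c * n" using pos by (simp add: mult.assoc mult.left_commute)
    have "\<delta> * n\<^sup>2 * real k \<le> 2 * e * (\<beta> * n)"
      using mult_right_mono[OF E, of n] n by (simp add: e_def power2_eq_square algebra_simps)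
    then have "2 * e * (\<rho> * n) \<le> (2 * e - \<delta> * n\<^sup>2) * real k"
      using n by (simp add: \<rho>_def algebra_simps)
    moreover have "0 \<le> 2 * e * (\<rho> * n)" using e0 rho n by simp
    ultimately have "0 \<le> 2 * e - \<delta> * n\<^sup>2" using k0 by (smt (verit) mult_neg_pos)
    then have "(2 * e - \<delta> * n\<^sup>2) * real k \<le> (2 * e - \<delta> * n\<^sup>2) * (2 * c * n)"
      using kn by (intro mult_left_mono)
    with \<open>2 * e * (\<rho> * n) \<le> (2 * e - \<delta> * n\<^sup>2) * real k\<close>
    have "(2 * e * \<rho>) * n \<le> (2 * c * (2 * e - \<delta> * n\<^sup>2)) * n" by (simp add: algebra_simps)
    then show ?thesis using n by simp
  qed
  ultimately show False by simp
qed

text \<open>Trimming leaves at least \<open>\<alpha> * n\<close> colors with exactly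
  \<open>k\<close> edges each, and by \<open>\<delta> \<le> 2 * \<alpha> * \<beta>\<close> this is
  the edge bound of \<open>no_dense_coloring\<close>. Deleting edges creates no rainbow
  triangle.\<close>

lemma rainbow_triangle_exists:
  fixes V :: "'a set" and E :: "'a set set" and f :: "'a set \<Rightarrow> nat"
    and \<alpha> \<beta> \<delta> \<mu> \<nu> c :: real
  assumes gw: "good_weights \<beta> \<delta> \<mu> \<nu> c" and pos: "0 < c" "0 < \<delta>" "\<beta> \<le> 2 * c * \<delta>"
    and \<delta>: "\<delta> \<le> 2 * \<alpha> * \<beta>"
    and graph: "simple_graph V E" and nonempty: "V \<noteq> {}"
    and classes: "\<alpha> * real (card V) \<le>
      real (card {i. \<beta> * real (card V) \<le> real (card (color_class E f i))})"
  shows "\<exists>x y z. rainbow_triangle E f x y z"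
proof (rule ccontr)
  assume none: "\<nexists>x y z. rainbow_triangle E f x y z"
  interpret gw: good_weights \<beta> \<delta> \<mu> \<nu> c by fact
  define n where "n = real (card V)"
  define I where "I = {i. \<beta> * n \<le> real (card (color_class E f i))}"
  define k where "k = nat \<lceil>\<beta> * n\<rceil>"
  have n: "0 < n" using graph nonempty by (simp add: n_def simple_graph_def card_gt_0_iff)
  have bn: "0 < \<beta> * n" using gw.beta n by simp
  have k: "\<beta> * n \<le> real k" "real k - 1 < \<beta> * n" unfolding k_def using bn by linarith+
  have "E \<subseteq> Pow V" using graph by (auto simp: simple_graph_def)
  then have finE: "finite E" using graph by (meson finite_Pow_iff finite_subset simple_graph_def)
  have "\<exists>T. T \<subseteq> color_class E f i \<and> card T = k" if "i \<in> I" for i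
  proof -
    have "k \<le> card (color_class E f i)" using that unfolding I_def k_def by (simp add: nat_le_iff ceiling_le_iff)
    then show ?thesis by (meson obtain_subset_with_card_n)
  qed
  then obtain T where T: "\<And>i. i \<in> I \<Longrightarrow> T i \<subseteq> color_class E f i" "\<And>i. i \<in> I \<Longrightarrow> card (T i) = k"
    by metis
  define E' where "E' = (\<Union>i\<in>I. T i)"
  have finI: "finite I"
  proof (rule finite_subset)
    show "I \<subseteq> f ` E"
    proof
      fix i assume "i \<in> I"
      then have "card (color_class E f i) \<noteq> 0" using bn by (auto simp: I_def)
      then obtain e where "e \<in> color_class E f i" by fastforce
      then show "i \<in> f ` E" by (auto simp: color_class_def)
    qed
  qed (use finE in simp)
  have finT: "finite (T i)" if "i \<in> I" for i
    using T(1)[OF that] finE by (auto simp: color_class_def intro: finite_subset)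
  have col: "f e = i" if "i \<in> I" "e \<in> T i" for e i
    using T(1) that by (auto simp: color_class_def)
  have E'_sub: "E' \<subseteq> E" using T(1) by (auto simp: E'_def color_class_def)
  have cls: "color_class E' f i \<subseteq> T i" "i \<notin> I \<Longrightarrow> color_class E' f i = {}" for i
    using col by (auto simp: color_class_def E'_def)
  have "card E' = (\<Sum>i\<in>I. card (T i))"
    unfolding E'_def
  proof (rule card_UN_disjoint[OF finI])
    show "\<forall>i\<in>I. \<forall>j\<in>I. i \<noteq> j \<longrightarrow> T i \<inter> T j = {}" using col by (metis disjoint_iff)
  qed (use finT in blast)
  then have card_E': "card E' = card I * k" using T(2) by simp
  interpret rainbow_free V E' f k
  proof
    show "simple_graph V E'" using graph E'_sub by (auto simp: simple_graph_def)
    show "\<not> rainbow_triangle E' f x y z" for x y z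
      using none E'_sub by (auto simp: rainbow_triangle_def)
    show "card (color_class E' f i) \<le> k" for i
    proof (cases "i \<in> I")
      case True
      then show ?thesis using card_mono[OF finT cls(1)] T(2) by simp
    qed (simp add: cls(2))
  qed
  have "\<delta> * n * real k \<le> 2 * \<alpha> * \<beta> * n * real k"
    using \<delta> n by (intro mult_right_mono) auto
  also have "\<dots> = 2 * \<beta> * real k * (\<alpha> * n)" by simp
  also have "\<dots> \<le> 2 * \<beta> * real k * real (card I)"
    using classes gw.beta unfolding I_def n_def by (intro mult_left_mono) auto
  also have "\<dots> = 2 * \<beta> * real (card E')" by (simp add: card_E')
  finally show False
    using no_dense_coloring[OF gw pos nonempty] k unfolding n_def by blast
qed

theorem theorem1p4:
  fixes V :: "'a set" and E :: "'a set set" and f :: "'a set \<Rightarrow> nat" and n :: nat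
  assumes "simple_graph V E" and "V \<noteq> {}" and "card V = n"
  shows "(real (card {i. real (card (color_class E f i)) \<ge> real n / 3}) \<ge> 1.1077 * real n
            \<longrightarrow> (\<exists>x y z. rainbow_triangle E f x y z)) \<and>
         (real (card {i. real (card (color_class E f i)) \<ge> real n / 4}) \<ge> 1.3481 * real n
            \<longrightarrow> (\<exists>x y z. rainbow_triangle E f x y z))"
  using rainbow_triangle_exists[OF third.good_weights_axioms _ _ _ _ assms(1,2), of "1.1077" f]
    rainbow_triangle_exists[OF quarter.good_weights_axioms _ _ _ _ assms(1,2), of "1.3481" f] assms(3)
  by simp

end
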